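(* Let $X\subset\mathbb{C}^2$ be a reduced algebraic curve, let $\Gamma$ be a local branch of $\overline X$ at a point $\xi\in\overline X\cap Q^\infty$, and let $\hat u\in\Delta^{\mathrm{atyp}}_\xi(\Gamma)\neq\emptyset$. Let $\mathcal{B}\subset\mathbb{C}$ denote a small disk centred at the origin, and let $u:\mathcal{B}\to\mathbb{C}^2$ be a continuous path such that $u(0)=\hat u$ and that $h_k(u(s))\neq0$ for all $s\neq0$. Then the number of Morse points of $D_{u(s)}$ which abut to $\xi$ along $\Gamma$ when $s\to0$ is $$m_\Gamma(\hat u):=\operatorname{ord}_0\Bigl(\sum_{j>k}h_j(\hat u)t^j\Bigr)-\operatorname{mult}_\xi(\Gamma,H^\infty)$$ if $\operatorname{ord}_0\sum_{j>k}h_j(\hat u)t^j$ is finite. In this case, the integer $m_\Gamma(\hat u)>0$ is independent of the choice of the path $u(s)$ at $\hat u$.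
   Context: For $u=(u_1,u_2)\in\mathbb{C}^2$, $D_u(x,y)=(x-u_1)^2+(y-u_2)^2$. $X_{\mathrm{reg}}$ is the smooth part of $X$; a Morse point of $D_u$ is a nondegenerate critical point of $D_u|_{X_{\mathrm{reg}}}$. $\overline X\subset\mathbb{P}^2$ is the projective closure of $X$, $H^\infty$ is the line at infinity, and $Q^\infty=\{x^2+y^2=0\}\subset H^\infty$ is the set of the two isotropic points $[1;i]$, $[i;1]$. $\operatorname{mult}_\xi(\Gamma,H^\infty)$ is the intersection multiplicity of the branch $\Gamma$ with $H^\infty$ at $\xi$. $\Delta^{\mathrm{atyp}}_\xi(\Gamma)$ is the set of $u\in\mathbb{C}^2$ such that there are sequences $u_n\to u$ in $\mathbb{C}^2$ and $\mathbf{x}_n\in\Gamma\setminus H^\infty$, $\mathbf{x}_n\to\xi$, with $\langle u_n-\mathbf{x}_n,v\rangle=0$ for all $v\in T_{\mathbf{x}_n}X_{\mathrm{reg}}$, where $\langle a,b\rangle=a_1b_1+a_2b_2$. Let $\gamma:B\to\Gamma$ be a local holomorphic parametrization of the branch, $B\subset\mathbb{C}$ a small disk centred at $0$, $\gamma(0)=\xi$. In the affine coordinates of $\mathbb{C}^2$ write $x(t)=P(t)/t^k$, $y(t)=Q(t)/t^k$, with $P,Q$ holomorphic and $P(0),Q(0)$ not both zero (one has $k=\operatorname{mult}_\xi(\Gamma,H^\infty)$). Define $$h(t,u)=\bigl(tP'(t)-kP(t)\bigr)\bigl(P(t)-u_1t^k\bigr)+\bigl(tQ'(t)-kQ(t)\bigr)\bigl(Q(t)-u_2t^k\bigr)=\sum_{j\ge0}h_j(u)t^j.$$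 For $t\neq0$ small, $h(t,u)=0$ if and only if $\gamma(t)$ is a critical point of $D_u|_{X_{\mathrm{reg}}}$. A Morse point of $D_{u(s)}$ abuts to $\xi$ along $\Gamma$ if it lies on $\Gamma$ and converges to $\xi$ when $s\to0$.
   Formalization: The number of Morse points is shown to be m only for paths along which all critical points of D_{u(s)} on Γ near ξ are Morse for small s≠0 (otherwise the claim fails); for every path, critical points are counted with Milnor number. *)

theory Defs
  imports
    "HOL-Complex_Analysis.Complex_Analysis"
    "HOL-Computational_Algebra.Computational_Algebra"
begin

section \<open>Affine plane curves\<close>

text \<open>
  A bivariate polynomial \<open>F\<close> is a polynomial in \<open>y\<close> whose coefficients are polynomials in \<open>x\<close>.
\<close>

type_synonym point = "complex \<times> complex"

definition eval2 :: "complex poly poly \<Rightarrow> point \<Rightarrow> complex" where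
  "eval2 F p = poly (poly F [:snd p:]) (fst p)"

definition partial_x :: "complex poly poly \<Rightarrow> complex poly poly" where
  "partial_x F = map_poly pderiv F"

definition partial_y :: "complex poly poly \<Rightarrow> complex poly poly" where
  "partial_y F = pderiv F"

definition curve :: "complex poly poly \<Rightarrow> point set" where
  "curve F = {p. eval2 F p = 0}"

definition reduced_equation :: "complex poly poly \<Rightarrow> bool" where
  "reduced_equation F \<longleftrightarrow> squarefree F \<and> \<not> is_unit F"

text \<open>
  The notions below that mention the gradient of \<open>F\<close> are the correct ones for
  \<open>curve F\<close> only when \<open>F\<close> is a reduced equation.
\<close>

definition regular_part :: "complex poly poly \<Rightarrow> point set" where
  "regular_part F =
     {p \<in> curve F. eval2 (partial_x F) p \<noteq> 0 \<or> eval2 (partial_y F) p \<noteq> 0}"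

definition tangent_space :: "complex poly poly \<Rightarrow> point \<Rightarrow> point set" where
  "tangent_space F p =
     {v. eval2 (partial_x F) p * fst v + eval2 (partial_y F) p * snd v = 0}"

text \<open>The complex bilinear (not Hermitian) pairing and its quadratic distance function \<open>D\<^sub>u\<close>.\<close>

definition bilin :: "point \<Rightarrow> point \<Rightarrow> complex" where
  "bilin a b = fst a * fst b + snd a * snd b"

definition dist_sq :: "point \<Rightarrow> point \<Rightarrow> complex" where
  "dist_sq u p = (fst p - fst u)\<^sup>2 + (snd p - snd u)\<^sup>2"

section \<open>Critical points on the regular part\<close>

text \<open>
  At a point \<open>p\<close> of \<open>regular_part F\<close>, the maps \<open>\<phi>\<close> below are the local holomorphic coordinates
  (inverse charts) of the Riemann surface \<open>regular_part F\<close> centred at \<open>p\<close>.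
\<close>

definition local_coordinate :: "complex poly poly \<Rightarrow> point \<Rightarrow> (complex \<Rightarrow> point) \<Rightarrow> bool" where
  "local_coordinate F p \<phi> \<longleftrightarrow>
     (\<lambda>t. fst (\<phi> t)) analytic_on {0} \<and> (\<lambda>t. snd (\<phi> t)) analytic_on {0} \<and>
     \<phi> 0 = p \<and>
     (deriv (\<lambda>t. fst (\<phi> t)) 0 \<noteq> 0 \<or> deriv (\<lambda>t. snd (\<phi> t)) 0 \<noteq> 0) \<and>
     (\<forall>\<^sub>F t in nhds 0. \<phi> t \<in> curve F)"

definition critical_point :: "complex poly poly \<Rightarrow> point \<Rightarrow> point \<Rightarrow> bool" where
  "critical_point F u p \<longleftrightarrow>
     p \<in> regular_part F \<and>
     (\<exists>\<phi>. local_coordinate F p \<phi> \<and> deriv (\<lambda>t. dist_sq u (\<phi> t)) 0 = 0)"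

definition morse_point :: "complex poly poly \<Rightarrow> point \<Rightarrow> point \<Rightarrow> bool" where
  "morse_point F u p \<longleftrightarrow>
     p \<in> regular_part F \<and>
     (\<exists>\<phi>. local_coordinate F p \<phi> \<and> deriv (\<lambda>t. dist_sq u (\<phi> t)) 0 = 0 \<and>
          (deriv ^^ 2) (\<lambda>t. dist_sq u (\<phi> t)) 0 \<noteq> 0)"

text \<open>
  The Milnor number of \<open>D\<^sub>u\<close> restricted to \<open>regular_part F\<close>, i.e. the number of Morse points into
  which the critical point \<open>p\<close> splits under a generic perturbation; it is \<open>1\<close> at a Morse point.
\<close>

definition milnor :: "complex poly poly \<Rightarrow> point \<Rightarrow> point \<Rightarrow> int" where
  "milnor F u p =
     (THE n. \<exists>\<phi>. local_coordinate F p \<phi> \<and> zorder (deriv (\<lambda>t. dist_sq u (\<phi> t))) 0 = n)"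

section \<open>The complex projective plane\<close>

definition homog_rel ::
    "complex \<times> complex \<times> complex \<Rightarrow> complex \<times> complex \<times> complex \<Rightarrow> bool" where
  "homog_rel v w \<longleftrightarrow> v \<noteq> (0, 0, 0) \<and> w \<noteq> (0, 0, 0) \<and>
     (\<exists>c. c \<noteq> 0 \<and> w = (c * fst v, c * fst (snd v), c * snd (snd v)))"

lemma homog_rel_self: "homog_rel v v \<longleftrightarrow> v \<noteq> (0, 0, 0)"
  unfolding homog_rel_def by (cases v) (auto intro!: exI[of _ 1])

quotient_type cp2 = "complex \<times> complex \<times> complex" / partial: homog_rel
proof (rule part_equivpI)
  show "\<exists>v. homog_rel v v"
    by (rule exI[of _ "(1, 0, 0)"]) (simp add: homog_rel_self)
  show "symp homog_rel"
  proof (rule sympI)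
    fix v w assume "homog_rel v w"
    then obtain c where "v \<noteq> (0, 0, 0)" "w \<noteq> (0, 0, 0)" "c \<noteq> 0"
      "w = (c * fst v, c * fst (snd v), c * snd (snd v))"
      unfolding homog_rel_def by blast
    then show "homog_rel w v"
      unfolding homog_rel_def by (auto simp: prod_eq_iff intro!: exI[of _ "inverse c"])
  qed
  show "transp homog_rel"
  proof (rule transpI)
    fix v w z assume "homog_rel v w" "homog_rel w z"
    then obtain c d where "v \<noteq> (0, 0, 0)" "z \<noteq> (0, 0, 0)" "c \<noteq> 0" "d \<noteq> 0"
      "w = (c * fst v, c * fst (snd v), c * snd (snd v))"
      "z = (d * fst w, d * fst (snd w), d * snd (snd w))"
      unfolding homog_rel_def by blast
    then show "homog_rel v z"
      unfolding homog_rel_def by (auto simp: prod_eq_iff intro!: exI[of _ "d * c"])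
  qed
qed

text \<open>\<open>cp2_of x y z\<close> is the point \<open>[x : y : z]\<close>; it is meaningless for \<open>x = y = z = 0\<close>.\<close>

definition cp2_of :: "complex \<Rightarrow> complex \<Rightarrow> complex \<Rightarrow> cp2" where
  "cp2_of x y z = abs_cp2 (x, y, z)"

instantiation cp2 :: topological_space
begin

text \<open>The quotient topology.\<close>

definition open_cp2 :: "cp2 set \<Rightarrow> bool" where
  "open_cp2 U \<longleftrightarrow> open {v. v \<noteq> (0, 0, 0) \<and> abs_cp2 v \<in> U}"

instance
proof
  have "{v :: complex \<times> complex \<times> complex. v \<noteq> (0, 0, 0)} = - {(0, 0, 0)}"
    by auto
  then show "open (UNIV :: cp2 set)"
    by (simp add: open_cp2_def open_Compl)
next
  fix S T :: "cp2 set"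
  assume "open S" "open T"
  moreover have "{v. v \<noteq> (0, 0, 0) \<and> abs_cp2 v \<in> S \<inter> T} =
      {v. v \<noteq> (0, 0, 0) \<and> abs_cp2 v \<in> S} \<inter> {v. v \<noteq> (0, 0, 0) \<and> abs_cp2 v \<in> T}"
    by auto
  ultimately show "open (S \<inter> T)"
    unfolding open_cp2_def by (simp add: open_Int)
next
  fix K :: "cp2 set set"
  assume "\<forall>S\<in>K. open S"
  moreover have "{v. v \<noteq> (0, 0, 0) \<and> abs_cp2 v \<in> \<Union>K} =
      (\<Union>S\<in>K. {v. v \<noteq> (0, 0, 0) \<and> abs_cp2 v \<in> S})"
    by auto
  ultimately show "open (\<Union>K)"
    unfolding open_cp2_def by (simp add: open_UN)
qed

end

definition aff :: "point \<Rightarrow> cp2" where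
  "aff p = cp2_of (fst p) (snd p) 1"

text \<open>The closure in the classical topology; for algebraic sets it is the Zariski closure.\<close>

definition proj_closure :: "complex poly poly \<Rightarrow> cp2 set" where
  "proj_closure F = closure (aff ` curve F)"

definition Q_inf :: "cp2 set" where
  "Q_inf = {cp2_of x y 0 | x y. (x, y) \<noteq> (0, 0) \<and> x\<^sup>2 + y\<^sup>2 = 0}"

lift_definition z_over_x :: "cp2 \<Rightarrow> complex" is "\<lambda>(x, y, z). z / x"
  unfolding homog_rel_def by auto

section \<open>Branches at infinity\<close>

definition branch_map ::
    "(complex \<Rightarrow> complex) \<Rightarrow> (complex \<Rightarrow> complex) \<Rightarrow> nat \<Rightarrow> complex \<Rightarrow> cp2" where
  "branch_map P Q k t = cp2_of (P t) (Q t) (t ^ k)"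

text \<open>
  \<open>\<Gamma>\<close> is (a representative of) a local branch at \<open>\<xi>\<close> of the projective closure, and
  \<open>\<gamma> t = [P t : Q t : t ^ k]\<close>, which is the affine point \<open>(P t / t ^ k, Q t / t ^ k)\<close> for \<open>t \<noteq> 0\<close>,
  is a holomorphic parametrization of it by the disk of radius \<open>r\<close>.  A parametrization of an
  irreducible curve germ by its normalization is a homeomorphism onto the germ; conversely a curve
  germ contained in the projective closure that has such a parametrization is irreducible of
  dimension one, hence an entire branch.
\<close>

definition branch_parametrization ::
    "complex poly poly \<Rightarrow> cp2 set \<Rightarrow> cp2 \<Rightarrow> real \<Rightarrow>
     (complex \<Rightarrow> complex) \<Rightarrow> (complex \<Rightarrow> complex) \<Rightarrow> nat \<Rightarrow> bool" where
  "branch_parametrization F \<Gamma> \<xi> r P Q k \<longleftrightarrow>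
     r > 0 \<and> P holomorphic_on ball 0 r \<and> Q holomorphic_on ball 0 r \<and>
     (P 0 \<noteq> 0 \<or> Q 0 \<noteq> 0) \<and>
     branch_map P Q k 0 = \<xi> \<and> \<Gamma> \<subseteq> proj_closure F \<and>
     (\<exists>g. homeomorphism (ball 0 r) \<Gamma> (branch_map P Q k) g)"

text \<open>
  The intersection multiplicity at \<open>\<gamma> 0\<close> of the branch parametrized by \<open>\<gamma>\<close> with the line at
  infinity: the order of the pull-back under \<open>\<gamma>\<close> of a local equation of that line.  The local
  equation \<open>z / x = 0\<close> is valid at all points \<open>[x : y : 0]\<close> with \<open>x \<noteq> 0\<close>, in particular at
  those of \<open>Q_inf\<close>.
\<close>

definition mult_at_infinity :: "(complex \<Rightarrow> cp2) \<Rightarrow> int" where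
  "mult_at_infinity \<gamma> = zorder (\<lambda>t. z_over_x (\<gamma> t)) 0"

definition atypical_discriminant :: "complex poly poly \<Rightarrow> cp2 set \<Rightarrow> cp2 \<Rightarrow> point set" where
  "atypical_discriminant F \<Gamma> \<xi> =
     {u. \<exists>un xn. un \<longlonglongrightarrow> u \<and>
           (\<forall>n. xn n \<in> regular_part F \<and> aff (xn n) \<in> \<Gamma> \<and>
                (\<forall>v \<in> tangent_space F (xn n). bilin (un n - xn n) v = 0)) \<and>
           (\<lambda>n. aff (xn n)) \<longlonglongrightarrow> \<xi>}"

definition h_fun ::
    "(complex \<Rightarrow> complex) \<Rightarrow> (complex \<Rightarrow> complex) \<Rightarrow> nat \<Rightarrow> complex \<Rightarrow> point \<Rightarrow> complex" where
  "h_fun P Q k t u =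
     (t * deriv P t - of_nat k * P t) * (P t - fst u * t ^ k) +
     (t * deriv Q t - of_nat k * Q t) * (Q t - snd u * t ^ k)"

definition h_coeff ::
    "(complex \<Rightarrow> complex) \<Rightarrow> (complex \<Rightarrow> complex) \<Rightarrow> nat \<Rightarrow> nat \<Rightarrow> point \<Rightarrow> complex" where
  "h_coeff P Q k j u = fps_nth (fps_expansion (\<lambda>t. h_fun P Q k t u) 0) j"

definition h_tail ::
    "(complex \<Rightarrow> complex) \<Rightarrow> (complex \<Rightarrow> complex) \<Rightarrow> nat \<Rightarrow> point \<Rightarrow> complex fps" where
  "h_tail P Q k u = Abs_fps (\<lambda>j. if j > k then h_coeff P Q k j u else 0)"

text \<open>Meaningful only if \<open>h_tail P Q k u \<noteq> 0\<close>, i.e. if its order is finite.\<close>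

definition m_branch ::
    "(complex \<Rightarrow> complex) \<Rightarrow> (complex \<Rightarrow> complex) \<Rightarrow> nat \<Rightarrow> point \<Rightarrow> int" where
  "m_branch P Q k u =
     int (subdegree (h_tail P Q k u)) - mult_at_infinity (branch_map P Q k)"

section \<open>Counting points that abut to a point at infinity\<close>

text \<open>
  Let \<open>S s\<close> be a set of affine points depending on the parameter \<open>s\<close>.  Exactly \<open>n\<close> of these points
  abut to \<open>\<xi>\<close> along \<open>\<Gamma>\<close> when \<open>s \<rightarrow> 0\<close> if, for each sufficiently small neighbourhood \<open>U\<close> of \<open>\<xi>\<close>,
  exactly \<open>n\<close> of them lie in \<open>\<Gamma> \<inter> U\<close> for all small \<open>s \<noteq> 0\<close>.  In the second definition each point
  counts with a weight.
\<close>

definition abutting_number ::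
    "cp2 set \<Rightarrow> cp2 \<Rightarrow> (complex \<Rightarrow> point set) \<Rightarrow> int \<Rightarrow> bool" where
  "abutting_number \<Gamma> \<xi> S n \<longleftrightarrow>
     (\<exists>U\<^sub>0. open U\<^sub>0 \<and> \<xi> \<in> U\<^sub>0 \<and>
        (\<forall>U. open U \<and> \<xi> \<in> U \<and> U \<subseteq> U\<^sub>0 \<longrightarrow>
           (\<forall>\<^sub>F s in at 0. finite {p \<in> S s. aff p \<in> \<Gamma> \<inter> U} \<and>
                          int (card {p \<in> S s. aff p \<in> \<Gamma> \<inter> U}) = n)))"

definition abutting_weight ::
    "cp2 set \<Rightarrow> cp2 \<Rightarrow> (complex \<Rightarrow> point set) \<Rightarrow> (complex \<Rightarrow> point \<Rightarrow> int) \<Rightarrow> int \<Rightarrow> bool" where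
  "abutting_weight \<Gamma> \<xi> S w n \<longleftrightarrow>
     (\<exists>U\<^sub>0. open U\<^sub>0 \<and> \<xi> \<in> U\<^sub>0 \<and>
        (\<forall>U. open U \<and> \<xi> \<in> U \<and> U \<subseteq> U\<^sub>0 \<longrightarrow>
           (\<forall>\<^sub>F s in at 0. finite {p \<in> S s. aff p \<in> \<Gamma> \<inter> U} \<and>
                          (\<Sum>p | p \<in> S s \<and> aff p \<in> \<Gamma> \<inter> U. w s p) = n)))"

text \<open>
  The distance functions along a path may have degenerate critical points arbitrarily close to
  \<open>\<xi>\<close> (if the path runs inside the evolute), although \<open>h_coeff P Q k k\<close> does not vanish on it: on
  the branch \<open>x + \<i>y = t + t ^ 3\<close>, \<open>x - \<i>y = 2 / t\<close> at \<open>t = 0\<close>, with the centre \<open>u\<close> given by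
  \<open>u\<^sub>1 - \<i>u\<^sub>2 = \<beta>\<close>, \<open>u\<^sub>1 + \<i>u\<^sub>2 = (\<beta> s ^ 2 - 4 s ^ 3 + 3 \<beta> s ^ 4) / 2\<close>, \<open>\<beta> = 6 s / (1 + 6 s ^ 2)\<close>,
  two of the three critical points that abut to the point at infinity coincide for every \<open>s\<close>.
  Therefore the count is made either with Milnor numbers, or as a plain number of Morse points
  along the paths with the following property.
\<close>

definition only_morse_near ::
    "complex poly poly \<Rightarrow> cp2 set \<Rightarrow> cp2 \<Rightarrow> (complex \<Rightarrow> point) \<Rightarrow> bool" where
  "only_morse_near F \<Gamma> \<xi> u \<longleftrightarrow>
     (\<exists>V. open V \<and> \<xi> \<in> V \<and>
        (\<forall>\<^sub>F s in at 0. \<forall>p. critical_point F (u s) p \<and> aff p \<in> \<Gamma> \<inter> V \<longrightarrow>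
                          morse_point F (u s) p))"

end

theory Submission
  imports Defs "HOL-Computational_Algebra.Field_as_Ring"
begin

text \<open>
  The critical points of \<open>D\<^sub>u\<close> on the branch, near \<open>\<xi>\<close> but different from it, are the zeros
  \<open>t \<noteq> 0\<close> of \<open>h(t, u)\<close>, and their Milnor numbers are the multiplicities of these zeros.  One has
  \<open>h(t, u) = h(t, u\<^sub>0) + t\<^sup>k g(t, u)\<close>, where \<open>g\<close> is linear in \<open>u - u\<^sub>0\<close>.  If \<open>u\<^sub>0\<close> is atypical, there are
  \<open>t\<^sub>n \<rightarrow> 0\<close> with \<open>h(t\<^sub>n, u\<^sub>0) / t\<^sub>n\<^sup>k \<rightarrow> 0\<close>, hence \<open>h(t, u\<^sub>0) = t\<^sup>k T(t)\<close> with \<open>T\<close> of order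
  \<open>m = m_branch P Q k u\<^sub>0 > 0\<close> at \<open>0\<close>.  By Rouche's theorem, \<open>H = T + g\<close> has \<open>m\<close> zeros near \<open>0\<close> for \<open>u\<close>
  close to \<open>u\<^sub>0\<close>, and \<open>0\<close> is not one of them as \<open>H(0, u) = h\<^sub>k(u) \<noteq> 0\<close>.

  That the branch leaves the singular locus away from \<open>\<xi>\<close> follows from squarefreeness: the
  polynomials vanishing on it form a prime ideal, which meets the polynomials in \<open>x\<close> alone only in
  \<open>0\<close>, because \<open>x\<close> has a pole at \<open>\<xi>\<close>.
\<close>

section \<open>Regular points of squarefree curves\<close>

text \<open>Gauss's lemma: contents are multiplicative and \<open>M\<close> is primitive, so
  \<open>c\<close> divides the content of \<open>q\<close>. Hence \<open>c\<close> divides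
  \<open>q\<close> itself and can be cancelled.\<close>

lemma primitive_mult_dvd_smult:
  fixes M F q :: "'a :: {factorial_ring_gcd, semiring_gcd_mult_normalize} poly"
  assumes "content M = 1" and "c \<noteq> 0" and "smult c F = M * q"
  shows "M dvd F"
proof -
  have "content q = content (M * q)"
    by (simp add: content_mult assms(1))
  also have "\<dots> = normalize c * content F"
    using assms(3) by (metis content_smult)
  finally have "c dvd content q"
    by simp
  then have "[:c:] dvd q"
    by (simp add: const_poly_dvd_iff_dvd_content)
  then obtain q' where "q = smult c q'"
    by (auto elim!: dvdE)
  then have "smult c F = smult c (M * q')"
    using assms(3) by simp
  then have "smult c (F - M * q') = 0"
    by (simp add: smult_diff_right)
  then show ?thesis
    using \<open>c \<noteq> 0\<close> by simp
qed

text \<open>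
  A nonzero element of least degree of a prime ideal \<open>I\<close>, made primitive, divides every element of
  \<open>I\<close> by pseudo-division.  If \<open>F = N q\<close> and \<open>F'\<close> both lie in \<open>I\<close>, then so does \<open>N' q\<close>, hence \<open>q\<close>,
  and \<open>N\<^sup>2\<close> divides \<open>F\<close>.
\<close>

lemma squarefree_pderiv_notin_prime:
  fixes F :: "'a :: {factorial_ring_gcd, semiring_gcd_mult_normalize, ring_char_0} poly"
  assumes sf: "squarefree F" and F: "F \<in> I"
    and add: "\<And>A B. A \<in> I \<Longrightarrow> B \<in> I \<Longrightarrow> A - B \<in> I"
    and mult: "\<And>A B. A \<in> I \<Longrightarrow> A * B \<in> I"
    and prime: "\<And>A B. A * B \<in> I \<Longrightarrow> A \<in> I \<or> B \<in> I"
    and const: "\<And>c. [:c:] \<in> I \<Longrightarrow> c = 0"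
  shows "pderiv F \<notin> I"
proof
  assume F': "pderiv F \<in> I"
  have "F \<noteq> 0"
    using sf by auto
  define M where "M = (ARG_MIN degree A. A \<in> I \<and> A \<noteq> 0)"
  have M: "M \<in> I" "M \<noteq> 0"
    using arg_min_natI[of "\<lambda>A. A \<in> I \<and> A \<noteq> 0" F degree] F \<open>F \<noteq> 0\<close> by (auto simp: M_def)
  have minimal: "degree M \<le> degree A" if "A \<in> I" "A \<noteq> 0" for A
    using arg_min_nat_le[of "\<lambda>A. A \<in> I \<and> A \<noteq> 0" A degree] that by (auto simp: M_def)
  have smultI: "smult c A \<in> I" if "A \<in> I" for c A
    using mult[OF that, of "[:c:]"] by simp
  \<comment> \<open>A nonzero constant lies outside \<open>I\<close>, so primeness cancels it. This
    lets \<open>N\<close> inherit membership in \<open>I\<close> from \<open>M\<close>.\<close>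
  have smultD: "A \<in> I" if "smult c A \<in> I" "c \<noteq> 0" for c A
    using prime[of "[:c:]" A] const[of c] that by auto
  define N where "N = primitive_part M"
  have N: "N \<in> I" "N \<noteq> 0" "content N = 1" "degree N = degree M"
    using M smultD[of "content M" N] by (auto simp: N_def)
  have divides: "N dvd A" if "A \<in> I" for A
  proof -
    obtain q s where qs: "pseudo_divmod A N = (q, s)"
      by fastforce
    \<comment> \<open>The power of the leading coefficient of \<open>N\<close> by which
      pseudo-division multiplies the dividend; it is nonzero.\<close>
    let ?c = "coeff N (degree N) ^ (Suc (degree A) - degree N)"
    have eq: "smult ?c A = N * q + s" and s: "s = 0 \<or> degree s < degree N"
      using pseudo_divmod[OF N(2) qs] by auto
    have "s = smult ?c A - N * q"
      using eq by simp
    then have "s \<in> I"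
      using that N add mult smultI by metis
    then have "s = 0"
      using s minimal[of s] N(4) by linarith
    then show ?thesis
      using eq N(2,3) \<open>s = 0\<close> by (intro primitive_mult_dvd_smult[of N ?c]) auto
  qed
  have deg: "degree N \<noteq> 0"
    using const N by (metis degree_eq_zeroE pCons_0_0)
  obtain q where q: "F = N * q"
    using divides[OF F] by (elim dvdE)
  \<comment> \<open>In characteristic 0 the derivative of the nonconstant \<open>N\<close> is
    nonzero, and its degree is below the minimal one in \<open>I\<close>.\<close>
  have "N' \<notin> I" if "N' = pderiv N" for N'
    using minimal[of N'] deg N(4) that degree_pderiv[of N] pderiv_eq_0_iff[of N] by fastforce
  moreover have "pderiv F = N * pderiv q + pderiv N * q"
    by (simp add: q pderiv_mult algebra_simps)
  then have "pderiv N * q = pderiv F - N * pderiv q"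
    by simp
  then have "pderiv N * q \<in> I"
    using add[OF F' mult[OF N(1)]] by metis
  ultimately have "q \<in> I"
    using prime by blast
  then have "N * N dvd F"
    using divides q by (auto intro: mult_dvd_mono)
  then have "is_unit N"
    using sf by (simp add: squarefree_def power2_eq_square)
  then show False
    using deg by (auto simp: is_unit_poly_iff)
qed

section \<open>Evaluation and partial derivatives of bivariate polynomials\<close>

lemma eval2_pCons [simp]: "eval2 (pCons a F) p = poly a (fst p) + snd p * eval2 F p"
  by (simp add: eval2_def)

lemma eval2_0 [simp]: "eval2 0 p = 0"
  by (simp add: eval2_def)

lemma eval2_add: "eval2 (F + G) p = eval2 F p + eval2 G p"
  by (simp add: eval2_def)

lemma eval2_diff: "eval2 (F - G) p = eval2 F p - eval2 G p"
  by (simp add: eval2_def)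

lemma eval2_mult: "eval2 (F * G) p = eval2 F p * eval2 G p"
  by (simp add: eval2_def)

lemma partial_x_pCons [simp]: "partial_x (pCons a F) = pCons (pderiv a) (partial_x F)"
  by (simp add: partial_x_def map_poly_pCons)

lemma partial_x_0 [simp]: "partial_x 0 = 0"
  by (simp add: partial_x_def)

lemma partial_y_pCons [simp]: "partial_y (pCons a F) = F + pCons 0 (partial_y F)"
  by (simp add: partial_y_def pderiv_pCons)

lemma partial_y_0 [simp]: "partial_y 0 = 0"
  by (simp add: partial_y_def)

lemma eval2_has_field_derivative:
  assumes "(x has_field_derivative x') (at t)" "(y has_field_derivative y') (at t)"
  shows "((\<lambda>t. eval2 F (x t, y t)) has_field_derivative
    (eval2 (partial_x F) (x t, y t) * x' + eval2 (partial_y F) (x t, y t) * y')) (at t)"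
proof (induction F)
  case (pCons a F)
  have "((\<lambda>t. poly a (x t)) has_field_derivative poly (pderiv a) (x t) * x') (at t)"
    using DERIV_chain2[OF poly_DERIV assms(1)] .
  from DERIV_add[OF this DERIV_mult[OF assms(2) pCons.IH]] show ?case
    by (simp add: eval2_add algebra_simps)
qed simp

lemma continuous_on_eval2: "continuous_on S (eval2 F)"
  by (induction F) (auto intro!: continuous_intros)

lemma eval2_meromorphic_on:
  assumes "x meromorphic_on S" "y meromorphic_on S"
  shows "(\<lambda>t. eval2 F (x t, y t)) meromorphic_on S"
proof (induction F)
  case (pCons a F)
  have "(\<lambda>t. poly a (x t)) meromorphic_on S"
    by (induction a) (auto intro!: meromorphic_intros assms)
  then show ?case
    using pCons.IH assms by (auto intro!: meromorphic_intros)
qed auto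

lemma eval2_holomorphic_on:
  assumes "x holomorphic_on S" "y holomorphic_on S"
  shows "(\<lambda>t. eval2 F (x t, y t)) holomorphic_on S"
proof (induction F)
  case (pCons a F)
  have "(\<lambda>t. poly a (x t)) holomorphic_on S"
    by (induction a) (auto intro!: holomorphic_intros assms)
  then show ?case
    using pCons.IH assms by (auto intro!: holomorphic_intros)
qed auto

text \<open>Where one factor is nonzero, which is an open set, the other one vanishes; by the
  identity theorem it then vanishes on all of \<open>S\<close>. This gives the primeness of
  vanishing ideals below.\<close>

lemma holomorphic_mult_eq_0:
  assumes "f holomorphic_on S" "g holomorphic_on S" "open S" "connected S"
    and "\<And>z. z \<in> S \<Longrightarrow> f z * g z = 0"
  shows "(\<forall>z\<in>S. f z = 0) \<or> (\<forall>z\<in>S. g z = 0)"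
proof (rule ccontr)
  assume "\<not> ?thesis"
  then obtain a where a: "a \<in> S" "f a \<noteq> 0" and nz: "\<not> (\<forall>z\<in>S. g z = 0)"
    by blast
  have "continuous_on S f"
    using assms(1) by (rule holomorphic_on_imp_continuous_on)
  then have "open {z \<in> S. f z \<in> -{0}}"
    using assms(3) by (intro continuous_open_preimage[unfolded vimage_def Int_def, simplified]) auto
  moreover have "g z = 0" if "z \<in> {z \<in> S. f z \<in> -{0}}" for z
    using that assms(5)[of z] by auto
  ultimately have "g z = 0" if "z \<in> S" for z
    using analytic_continuation_open[of "{z \<in> S. f z \<in> -{0}}" S g "\<lambda>_. 0" z] a assms that
    by auto
  then show False
    using nz by blast
qed

text \<open>The polynomials that vanish along the parametrized arc form a prime ideal, to which
  \<open>squarefree_pderiv_notin_prime\<close> applies with polynomials in \<open>x\<close> as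
  coefficients.\<close>

lemma partial_y_not_identically_0:
  assumes F: "squarefree F" and S: "open S" "connected S"
    and xy: "x holomorphic_on S" "y holomorphic_on S" and x: "\<not> x constant_on S"
    and vanish: "\<And>t. t \<in> S \<Longrightarrow> eval2 F (x t, y t) = 0"
  shows "\<exists>t\<in>S. eval2 (partial_y F) (x t, y t) \<noteq> 0"
proof -
  define I where "I = {A. \<forall>t\<in>S. eval2 A (x t, y t) = 0}"
  have "pderiv F \<notin> I"
  proof (rule squarefree_pderiv_notin_prime[OF F])
    fix c assume "[:c:] \<in> I"
    then have c: "poly c (x t) = 0" if "t \<in> S" for t
      using that by (auto simp: I_def)
    \<comment> \<open>A nonzero polynomial in \<open>x\<close> alone has finitely many roots, so the
      continuous function \<open>x\<close> would take finitely many values on a connected set and be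
      constant.\<close>
    show "c = 0"
    proof (rule ccontr)
      assume "c \<noteq> 0"
      then have "finite {z. poly c z = 0}"
        by (rule poly_roots_finite)
      then have "finite (x ` S)"
        by (rule finite_subset[rotated]) (use c in auto)
      moreover have "continuous_on S x"
        using xy(1) by (rule holomorphic_on_imp_continuous_on)
      ultimately have "x constant_on S"
        using continuous_finite_range_constant[OF S(2)] by blast
      then show False
        using x by blast
    qed
  next
    fix A B assume "A * B \<in> I"
    then show "A \<in> I \<or> B \<in> I"
      using holomorphic_mult_eq_0[OF eval2_holomorphic_on[OF xy, of A]
          eval2_holomorphic_on[OF xy, of B] S]
      by (auto simp: I_def eval2_mult)
  qed (use vanish in \<open>auto simp: I_def eval2_mult eval2_diff\<close>)
  then show ?thesis
    by (auto simp: I_def partial_y_def)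
qed

section \<open>The projective plane\<close>

lemma cp2_of_eq_iff:
  assumes "(x, y, z) \<noteq> (0, 0, 0)" "(x', y', z') \<noteq> (0, 0, 0)"
  shows "cp2_of x y z = cp2_of x' y' z' \<longleftrightarrow> (\<exists>c. c \<noteq> 0 \<and> x' = c * x \<and> y' = c * y \<and> z' = c * z)"
proof -
  have "cp2_of x y z = cp2_of x' y' z' \<longleftrightarrow> homog_rel (x, y, z) (x', y', z')"
    using Quotient3_rel[OF Quotient3_cp2, of "(x, y, z)" "(x', y', z')"] assms
    unfolding cp2_of_def homog_rel_self by blast
  then show ?thesis
    using assms by (simp add: homog_rel_def)
qed

lemma z_over_x_cp2_of: "(x, y, z) \<noteq> (0, 0, 0) \<Longrightarrow> z_over_x (cp2_of x y z) = z / x"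
  unfolding cp2_of_def by (subst z_over_x.abs_eq) (auto simp: homog_rel_self)

lemma cp2_of_eq_aff: "z \<noteq> 0 \<Longrightarrow> cp2_of x y z = aff (x / z, y / z)"
  unfolding aff_def by (subst cp2_of_eq_iff) (auto intro!: exI[of _ "inverse z"] simp: field_simps)

lemma aff_eq_iff [simp]: "aff p = aff q \<longleftrightarrow> p = q"
  by (auto simp: aff_def cp2_of_eq_iff prod_eq_iff)

lemma cp2_of_eq_aff_iff:
  assumes "(x, y, z) \<noteq> (0, 0, 0)"
  shows "cp2_of x y z = aff p \<longleftrightarrow> z \<noteq> 0 \<and> p = (x / z, y / z)"
proof (cases "z = 0")
  case True
  then show ?thesis
    using assms by (auto simp: aff_def cp2_of_eq_iff)
next
  case False
  then show ?thesis
    by (auto simp: cp2_of_eq_aff)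
qed

text \<open>In homogeneous coordinates the image of \<open>V\<close> is the preimage of
  \<open>V\<close> under dehomogenization, which is continuous on the open set where the last
  coordinate is nonzero.\<close>

lemma open_aff_image:
  assumes "open V"
  shows "open (aff ` V)"
proof -
  have "abs_cp2 v \<in> aff ` V \<longleftrightarrow> v \<in> {v. snd (snd v) \<noteq> 0 \<and>
      (fst v / snd (snd v), fst (snd v) / snd (snd v)) \<in> V}" if "v \<noteq> (0, 0, 0)" for v
  proof -
    obtain x y z where v: "v = (x, y, z)"
      by (cases v) auto
    have "abs_cp2 v \<in> aff ` V \<longleftrightarrow> (\<exists>p\<in>V. cp2_of x y z = aff p)"
      unfolding v cp2_of_def by auto
    also have "\<dots> \<longleftrightarrow> z \<noteq> 0 \<and> (x / z, y / z) \<in> V"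
      using cp2_of_eq_aff_iff[of x y z] that v by auto
    finally show ?thesis
      by (simp add: v)
  qed
  then have eq: "{v. v \<noteq> (0, 0, 0) \<and> abs_cp2 v \<in> aff ` V} = {v. snd (snd v) \<noteq> 0} \<inter>
      (\<lambda>v. (fst v / snd (snd v), fst (snd v) / snd (snd v))) -` V"
    by auto
  have "open {v :: complex \<times> complex \<times> complex. snd (snd v) \<noteq> 0}"
    by (intro open_Collect_neq continuous_intros)
  then show ?thesis
    unfolding open_cp2_def eq
    by (intro continuous_open_preimage assms) (auto intro!: continuous_intros)
qed

text \<open>The complement of the curve has an open image under \<open>aff\<close>, disjoint from
  that of the curve, so taking the closure adds points at infinity only.\<close>

lemma aff_in_proj_closure_iff: "aff p \<in> proj_closure F \<longleftrightarrow> p \<in> curve F"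
proof
  assume p: "aff p \<in> proj_closure F"
  have "open (- curve F)"
    unfolding curve_def Collect_neg_eq[symmetric]
    by (intro open_Collect_neq continuous_on_eval2 continuous_intros)
  then have "open (aff ` (- curve F))"
    by (rule open_aff_image)
  then have "aff ` (- curve F) \<inter> closure (aff ` curve F) = {}"
    by (subst open_Int_closure_eq_empty) auto
  then show "p \<in> curve F"
    using p unfolding proj_closure_def by blast
next
  assume "p \<in> curve F"
  then show "aff p \<in> proj_closure F"
    unfolding proj_closure_def using closure_subset[of "aff ` curve F"] by auto
qed

section \<open>Local coordinates and Milnor numbers\<close>

text \<open>An implicit function argument without existence: near \<open>p\<close> the map
  \<open>F(a, w) - c * w\<close> of \<open>w\<close> is Lipschitz with constant
  \<open>norm c / 2\<close>, too small to cancel \<open>c * w\<close>.\<close>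

lemma eval2_locally_inj:
  assumes "eval2 (partial_y F) p \<noteq> 0"
  obtains d where "d > 0" and
    "\<And>a y z. a \<in> ball (fst p) d \<Longrightarrow> y \<in> ball (snd p) d \<Longrightarrow> z \<in> ball (snd p) d \<Longrightarrow>
      eval2 F (a, y) = eval2 F (a, z) \<Longrightarrow> y = z"
proof -
  define c where "c = eval2 (partial_y F) p"
  have "c \<noteq> 0"
    using assms by (simp add: c_def)
  have "isCont (eval2 (partial_y F)) p"
    using continuous_on_eval2 continuous_on_eq_continuous_at open_UNIV UNIV_I by blast
  then obtain e where "e > 0" and e: "\<And>q. dist q p < e \<Longrightarrow> dist (eval2 (partial_y F) q) c < norm c / 2"
    unfolding continuous_at_eps_delta c_def using \<open>c \<noteq> 0\<close> c_def by (metis half_gt_zero zero_less_norm_iff)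
  show ?thesis
  \<comment> \<open>Half of \<open>e\<close> for each coordinate keeps the distance of the pair to
    \<open>p\<close> below \<open>e\<close>.\<close>
  proof (rule that[of "e / 2"])
    fix a y z
    assume a: "a \<in> ball (fst p) (e/2)" and yz: "y \<in> ball (snd p) (e/2)" "z \<in> ball (snd p) (e/2)"
      and eq: "eval2 F (a, y) = eval2 F (a, z)"
    have near: "norm (eval2 (partial_y F) (a, w) - c) \<le> norm c / 2" if "w \<in> ball (snd p) (e/2)" for w
    proof -
      have "dist (a, w) p \<le> dist a (fst p) + dist w (snd p)"
        by (cases p) (simp add: dist_prod_def sqrt_sum_squares_le_sum)
      also have "\<dots> < e"
        using a that by (simp add: dist_commute)
      finally show ?thesis
        using e[of "(a, w)"] by (simp add: dist_norm)
    qed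
    have deriv: "((\<lambda>w. eval2 F (a, w) - c * w) has_field_derivative (eval2 (partial_y F) (a, w) - c))
        (at w within ball (snd p) (e/2))" for w
    proof -
      have "((\<lambda>w. eval2 F (a, w)) has_field_derivative eval2 (partial_y F) (a, w)) (at w)"
        using eval2_has_field_derivative[OF DERIV_const DERIV_ident, of F a w] by simp
      from DERIV_diff[OF this DERIV_cmult_Id] show ?thesis
        by (rule has_field_derivative_at_within)
    qed
    have "norm ((eval2 F (a, y) - c * y) - (eval2 F (a, z) - c * z)) \<le> norm c / 2 * norm (y - z)"
      by (rule field_differentiable_bound[OF convex_ball deriv near yz])
    then have "norm c * norm (y - z) \<le> norm c / 2 * norm (y - z)"
      by (simp add: eq flip: norm_mult) (simp add: algebra_simps norm_minus_commute)
    then show "y = z"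
      using \<open>c \<noteq> 0\<close> by (simp add: field_simps)
  qed (use \<open>e > 0\<close> in auto)
qed
lemma local_coordinate_has_derivs:
  assumes "local_coordinate F p \<phi>"
  shows "((\<lambda>t. fst (\<phi> t)) has_field_derivative deriv (\<lambda>t. fst (\<phi> t)) 0) (at 0)"
    and "((\<lambda>t. snd (\<phi> t)) has_field_derivative deriv (\<lambda>t. snd (\<phi> t)) 0) (at 0)"
  using assms unfolding local_coordinate_def
  by (auto intro: analytic_on_imp_differentiable_at simp: DERIV_deriv_iff_field_differentiable)

text \<open>Differentiate the identity expressing that \<open>F\<close> vanishes along
  \<open>\<phi>\<close>.\<close>

lemma local_coordinate_tangent:
  assumes "local_coordinate F p \<phi>"
  shows "eval2 (partial_x F) p * deriv (\<lambda>t. fst (\<phi> t)) 0 +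
    eval2 (partial_y F) p * deriv (\<lambda>t. snd (\<phi> t)) 0 = 0"
proof -
  have "((\<lambda>t. eval2 F (fst (\<phi> t), snd (\<phi> t))) has_field_derivative
      eval2 (partial_x F) p * deriv (\<lambda>t. fst (\<phi> t)) 0 +
      eval2 (partial_y F) p * deriv (\<lambda>t. snd (\<phi> t)) 0) (at 0)"
    using eval2_has_field_derivative[OF local_coordinate_has_derivs[OF assms], of F] assms
    by (simp add: local_coordinate_def)
  moreover have "\<forall>\<^sub>F t in nhds 0. eval2 F (fst (\<phi> t), snd (\<phi> t)) = 0"
    using assms by (simp add: local_coordinate_def curve_def)
  then have "((\<lambda>t. eval2 F (fst (\<phi> t), snd (\<phi> t))) has_field_derivative 0) (at 0)"
    by (subst DERIV_cong_ev[OF refl _ refl]) auto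
  ultimately show ?thesis
    by (rule DERIV_unique)
qed

text \<open>Otherwise the tangency relation would also annihilate the derivative of the second
  coordinate, against the immersion condition.\<close>

lemma local_coordinate_deriv_fst:
  assumes "local_coordinate F p \<phi>" "eval2 (partial_y F) p \<noteq> 0"
  shows "deriv (\<lambda>t. fst (\<phi> t)) 0 \<noteq> 0"
  using local_coordinate_tangent[OF assms(1)] assms by (auto simp: local_coordinate_def)

lemma isCont_tendsto_nhds: "isCont f a \<Longrightarrow> (f \<longlongrightarrow> f a) (nhds a)"
  by (simp add: isCont_def tendsto_at_iff_tendsto_nhds)

lemma local_coordinate_tendsto:
  assumes "local_coordinate F p \<phi>"
  shows "((\<lambda>t. fst (\<phi> t)) \<longlongrightarrow> fst p) (nhds 0)" "((\<lambda>t. snd (\<phi> t)) \<longlongrightarrow> snd p) (nhds 0)"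
proof -
  have "isCont (\<lambda>t. fst (\<phi> t)) 0" "isCont (\<lambda>t. snd (\<phi> t)) 0"
    using assms analytic_at_imp_isCont by (auto simp: local_coordinate_def)
  then show "((\<lambda>t. fst (\<phi> t)) \<longlongrightarrow> fst p) (nhds 0)" "((\<lambda>t. snd (\<phi> t)) \<longlongrightarrow> snd p) (nhds 0)"
    using assms isCont_tendsto_nhds unfolding local_coordinate_def by metis+
qed

lemma analytic_local_inverse:
  fixes f :: "complex \<Rightarrow> complex"
  assumes "f analytic_on {a}" "deriv f a \<noteq> 0"
  obtains g where "g analytic_on {f a}" "g (f a) = a" "\<forall>\<^sub>F z in nhds (f a). f (g z) = z"
proof -
  obtain S where S: "a \<in> S" "open S" "f holomorphic_on S"
    using assms(1) analytic_at by blast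
  obtain r where r: "r > 0" "ball a r \<subseteq> S" "open (f ` ball a r)" "inj_on f (ball a r)"
    using has_complex_derivative_locally_invertible[OF S(3,1,2) assms(2)] by blast
  obtain g where g: "g holomorphic_on f ` ball a r"
      "\<And>z. z \<in> ball a r \<Longrightarrow> deriv f z * deriv g (f z) = 1" "\<And>z. z \<in> ball a r \<Longrightarrow> g (f z) = z"
    by (rule holomorphic_has_inverse[OF holomorphic_on_subset[OF S(3) r(2)] open_ball r(4)]) blast
  have fa: "f a \<in> f ` ball a r"
    using r(1) by auto
  show ?thesis
  proof (rule that[of g])
    show "g analytic_on {f a}"
      using g(1) r(3) fa analytic_at by blast
    show "g (f a) = a"
      using g(3) r(1) by auto
    show "\<forall>\<^sub>F z in nhds (f a). f (g z) = z"
      using eventually_nhds_in_open[OF r(3) fa] by eventually_elim (use g(3) in auto)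
  qed
qed

text \<open>
  Equating the first coordinates determines \<open>\<sigma>\<close>; the second coordinates then agree because near
  \<open>p\<close> the curve is a graph over the first one.
\<close>

lemma local_coordinate_reparametrize:
  assumes \<phi>: "local_coordinate F p \<phi>" and \<psi>: "local_coordinate F p \<psi>"
    and p: "eval2 (partial_y F) p \<noteq> 0"
  obtains \<sigma> where "\<sigma> analytic_on {0}" "\<sigma> 0 = 0" "deriv \<sigma> 0 \<noteq> 0" "\<forall>\<^sub>F t in nhds 0. \<phi> t = \<psi> (\<sigma> t)"
proof -
  have [simp]: "\<phi> 0 = p" "\<psi> 0 = p"
    using \<phi> \<psi> by (auto simp: local_coordinate_def)
  have an: "(\<lambda>t. fst (\<phi> t)) analytic_on {0}" "(\<lambda>t. fst (\<psi> t)) analytic_on {0}"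
    using \<phi> \<psi> by (auto simp: local_coordinate_def)
  obtain g where g: "g analytic_on {fst p}" "g (fst p) = 0" "\<forall>\<^sub>F z in nhds (fst p). fst (\<psi> (g z)) = z"
    using analytic_local_inverse[OF an(2) local_coordinate_deriv_fst[OF \<psi> p]] by auto
  define \<sigma> where "\<sigma> = (\<lambda>t. g (fst (\<phi> t)))"
  have \<sigma>0: "\<sigma> 0 = 0"
    using g(2) by (simp add: \<sigma>_def)
  have \<sigma>: "\<sigma> analytic_on {0}"
    using analytic_on_compose[OF an(1), of g] g(1) by (simp add: \<sigma>_def o_def)
  have lim: "(\<sigma> \<longlongrightarrow> 0) (nhds 0)"
    using isCont_tendsto_nhds[OF analytic_at_imp_isCont[OF \<sigma>]] \<sigma>0 by simp
  have fst_eq: "\<forall>\<^sub>F t in nhds 0. fst (\<psi> (\<sigma> t)) = fst (\<phi> t)"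
    unfolding \<sigma>_def using filterlim_iff local_coordinate_tendsto(1)[OF \<phi>] g(3) by fastforce
  obtain d where d: "d > 0"
    "\<And>a y z. a \<in> ball (fst p) d \<Longrightarrow> y \<in> ball (snd p) d \<Longrightarrow> z \<in> ball (snd p) d \<Longrightarrow>
      eval2 F (a, y) = eval2 F (a, z) \<Longrightarrow> y = z"
    using eval2_locally_inj[OF p] by blast
  have near: "\<forall>\<^sub>F t in nhds 0. fst (\<phi> t) \<in> ball (fst p) d" "\<forall>\<^sub>F t in nhds 0. snd (\<phi> t) \<in> ball (snd p) d"
    using local_coordinate_tendsto[OF \<phi>, THEN topological_tendstoD, OF open_ball] d(1)
    by simp_all
  have "((\<lambda>t. snd (\<psi> (\<sigma> t))) \<longlongrightarrow> snd p) (nhds 0)"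
    using filterlim_compose[OF local_coordinate_tendsto(2)[OF \<psi>] lim] .
  then have "\<forall>\<^sub>F t in nhds 0. snd (\<psi> (\<sigma> t)) \<in> ball (snd p) d"
    using topological_tendstoD[OF _ open_ball] d(1) centre_in_ball by metis
  moreover have "\<forall>\<^sub>F t in nhds 0. \<phi> t \<in> curve F"
    using \<phi> by (simp add: local_coordinate_def)
  moreover have "\<forall>\<^sub>F t in nhds 0. \<psi> t \<in> curve F"
    using \<psi> by (simp add: local_coordinate_def)
  then have "\<forall>\<^sub>F t in nhds 0. \<psi> (\<sigma> t) \<in> curve F"
    using lim filterlim_iff by fastforce
  ultimately have eq: "\<forall>\<^sub>F t in nhds 0. \<phi> t = \<psi> (\<sigma> t)"
    using fst_eq near
  proof eventually_elim
    case (elim t)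
    have "eval2 F (fst (\<phi> t), snd (\<phi> t)) = 0"
      using elim(2) by (simp add: curve_def)
    moreover have "eval2 F (fst (\<psi> (\<sigma> t)), snd (\<psi> (\<sigma> t))) = 0"
      using elim(3) by (simp add: curve_def)
    then have "eval2 F (fst (\<phi> t), snd (\<psi> (\<sigma> t))) = 0"
      by (simp only: elim(4))
    ultimately have "snd (\<phi> t) = snd (\<psi> (\<sigma> t))"
      using d(2) elim by auto
    then show ?case
      using elim by (auto simp: prod_eq_iff)
  qed
  \<comment> \<open>If it vanished, the chain rule would make the first coordinate of
    \<open>\<phi>\<close> stationary at 0.\<close>
  have "deriv \<sigma> 0 \<noteq> 0"
  proof
    assume zero: "deriv \<sigma> 0 = 0"
    have "(\<sigma> has_field_derivative 0) (at 0)"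
      using \<sigma> zero by (metis DERIV_deriv_iff_field_differentiable analytic_on_imp_differentiable_at singletonI)
    then have "((\<lambda>t. fst (\<psi> (\<sigma> t))) has_field_derivative deriv (\<lambda>t. fst (\<psi> t)) 0 * 0) (at 0)"
      using DERIV_chain2[of "\<lambda>t. fst (\<psi> t)" _ \<sigma> 0 0] local_coordinate_has_derivs(1)[OF \<psi>] \<sigma>0 by metis
    then have "((\<lambda>t. fst (\<phi> t)) has_field_derivative 0) (at 0)"
      using fst_eq by (subst DERIV_cong_ev[OF refl _ refl, of _ "\<lambda>t. fst (\<psi> (\<sigma> t))"]) (auto elim: eventually_mono)
    then show False
      using local_coordinate_deriv_fst[OF \<phi> p] by (simp add: DERIV_imp_deriv)
  qed
  then show ?thesis
    using that \<sigma> \<sigma>0 eq by blast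
qed

lemma analytic_eventually_neq:
  fixes f :: "complex \<Rightarrow> complex"
  assumes "f analytic_on {a}" "deriv f a \<noteq> 0"
  shows "\<forall>\<^sub>F t in at a. f t \<noteq> f a"
proof -
  have "(f has_field_derivative deriv f a) (at a)"
    using assms(1) by (simp add: DERIV_deriv_iff_field_differentiable analytic_on_imp_differentiable_at)
  then have "((\<lambda>t. (f t - f a) / (t - a)) \<longlongrightarrow> deriv f a) (at a)"
    by (simp add: has_field_derivative_iff)
  then have "\<forall>\<^sub>F t in at a. (f t - f a) / (t - a) \<noteq> 0"
    using assms(2) by (rule tendsto_imp_eventually_ne)
  then show ?thesis
    by eventually_elim auto
qed

text \<open>By the chain rule \<open>f' = (g' o \<sigma>) * \<sigma>'\<close>. The last factor is a
  unit at 0, and composition with \<open>\<sigma>\<close>, which has a simple zero, preserves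
  orders. Hence criticality and the Milnor number do not depend on the chart.\<close>

lemma analytic_reparametrize:
  fixes f g \<sigma> :: "complex \<Rightarrow> complex"
  assumes \<sigma>: "\<sigma> analytic_on {0}" "\<sigma> 0 = 0" "deriv \<sigma> 0 \<noteq> 0"
    and g: "g analytic_on {0}" and eq: "\<forall>\<^sub>F t in nhds 0. f t = g (\<sigma> t)"
  shows "deriv f 0 = deriv g 0 * deriv \<sigma> 0"
    and "\<forall>\<^sub>F t in at 0. deriv g t \<noteq> 0 \<Longrightarrow> zorder (deriv f) 0 = zorder (deriv g) 0"
proof -
  have lim: "(\<sigma> \<longlongrightarrow> 0) (nhds 0)"
    using isCont_tendsto_nhds[OF analytic_at_imp_isCont[OF \<sigma>(1)]] \<sigma>(2) by simp
  obtain A where A: "0 \<in> A" "open A" "g holomorphic_on A"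
    using g analytic_at by blast
  obtain B where B: "0 \<in> B" "open B" "\<sigma> holomorphic_on B"
    using \<sigma>(1) analytic_at by blast
  have chain: "deriv (\<lambda>t. g (\<sigma> t)) t = deriv g (\<sigma> t) * deriv \<sigma> t" if "t \<in> B" "\<sigma> t \<in> A" for t
  proof -
    have "(g has_field_derivative deriv g (\<sigma> t)) (at (\<sigma> t))"
      "(\<sigma> has_field_derivative deriv \<sigma> t) (at t)"
      using that A B holomorphic_derivI by blast+
    then show ?thesis
      by (intro DERIV_imp_deriv DERIV_chain2)
  qed
  have ev: "\<forall>\<^sub>F t in nhds 0. deriv f t = deriv g (\<sigma> t) * deriv \<sigma> t"
  proof -
    \<comment> \<open>Equality near 0 is also equality near every point close to 0, so the
      derivatives agree at those points as well.\<close>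
    have "\<forall>\<^sub>F t in nhds 0. \<forall>\<^sub>F w in nhds t. f w = g (\<sigma> w)"
      using eq by (simp add: eventually_eventually)
    moreover have "\<forall>\<^sub>F t in nhds 0. t \<in> B" "\<forall>\<^sub>F t in nhds 0. \<sigma> t \<in> A"
      using eventually_nhds_in_open B(1,2) topological_tendstoD[OF lim A(2,1)] by blast+
    ultimately show ?thesis
    proof eventually_elim
      case (elim t)
      then have "deriv f t = deriv (\<lambda>t. g (\<sigma> t)) t"
        by (intro deriv_cong_ev) auto
      then show ?case
        using chain elim by simp
    qed
  qed
  from eventually_nhds_x_imp_x[OF ev] show "deriv f 0 = deriv g 0 * deriv \<sigma> 0"
    by (simp add: \<sigma>(2))
  assume nz: "\<forall>\<^sub>F t in at 0. deriv g t \<noteq> 0"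
  have an: "deriv g analytic_on {0}" "deriv \<sigma> analytic_on {0}"
    using g \<sigma>(1) by (auto intro: analytic_deriv)
  have diff: "(\<lambda>t. \<sigma> t - \<sigma> 0) analytic_on {0}"
    by (intro analytic_intros \<sigma>)
  have d\<sigma>: "deriv (\<lambda>t. \<sigma> t - \<sigma> 0) 0 = deriv \<sigma> 0"
    using \<sigma>(1) by (subst deriv_diff) (auto intro: analytic_on_imp_differentiable_at)
  then have z\<sigma>: "zorder (\<lambda>t. \<sigma> t - \<sigma> 0) 0 = 1"
    using \<sigma>(3) by (intro zorder_zero_eqI'[OF diff]) auto
  have "\<forall>\<^sub>F t in at 0. \<sigma> t \<noteq> 0"
    using analytic_eventually_neq[OF \<sigma>(1,3)] \<sigma>(2) by simp
  have comp: "zorder (deriv g \<circ> \<sigma>) 0 = zorder (deriv g) 0"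
    using zorder_compose'[of "deriv g" \<sigma> 0] \<sigma> an nz z\<sigma> \<open>\<forall>\<^sub>F t in at 0. \<sigma> t \<noteq> 0\<close>
      isolated_singularity_at_analytic not_essential_analytic by simp
  have "\<forall>\<^sub>F t in at 0. deriv \<sigma> t \<noteq> 0"
    using analytic_at_imp_isCont[OF an(2)] \<sigma>(3) by (simp add: isCont_def tendsto_imp_eventually_ne)
  moreover have "filterlim \<sigma> (at 0) (at 0)"
    using lim \<open>\<forall>\<^sub>F t in at 0. \<sigma> t \<noteq> 0\<close>
    by (auto simp: filterlim_at intro: tendsto_mono[OF at_within_le_nhds])
  then have "\<forall>\<^sub>F t in at 0. deriv g (\<sigma> t) \<noteq> 0"
    using nz filterlim_iff by fastforce
  ultimately have "\<forall>\<^sub>F t in at 0. (deriv g \<circ> \<sigma>) t * deriv \<sigma> t \<noteq> 0"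
    by eventually_elim auto
  moreover have "(deriv g \<circ> \<sigma>) analytic_on {0}"
    using an(1) \<sigma> by (intro analytic_on_compose) auto
  ultimately have "zorder (\<lambda>t. (deriv g \<circ> \<sigma>) t * deriv \<sigma> t) 0 = zorder (deriv g) 0 + zorder (deriv \<sigma>) 0"
    using an(2) comp by (subst zorder_times_analytic) auto
  also have "zorder (deriv \<sigma>) 0 = 0"
    using an(2) \<sigma>(3) by (rule zorder_eq_0I)
  moreover have "zorder (deriv f) 0 = zorder (\<lambda>t. (deriv g \<circ> \<sigma>) t * deriv \<sigma> t) 0"
    using ev by (intro zorder_cong refl) (auto simp: eventually_at_filter elim: eventually_mono)
  ultimately show "zorder (deriv f) 0 = zorder (deriv g) 0"
    by simp
qed

lemma dist_sq_analytic:
  assumes "local_coordinate F p \<phi>"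
  shows "(\<lambda>t. dist_sq u (\<phi> t)) analytic_on {0}"
  using assms unfolding local_coordinate_def dist_sq_def by (intro analytic_intros) auto

lemma critical_point_iff:
  assumes "p \<in> regular_part F" "eval2 (partial_y F) p \<noteq> 0" and \<psi>: "local_coordinate F p \<psi>"
  shows "critical_point F u p \<longleftrightarrow> deriv (\<lambda>t. dist_sq u (\<psi> t)) 0 = 0"
proof
  assume "critical_point F u p"
  then obtain \<phi> where \<phi>: "local_coordinate F p \<phi>" "deriv (\<lambda>t. dist_sq u (\<phi> t)) 0 = 0"
    by (auto simp: critical_point_def)
  obtain \<sigma> where \<sigma>: "\<sigma> analytic_on {0}" "\<sigma> 0 = 0" "deriv \<sigma> 0 \<noteq> 0" "\<forall>\<^sub>F t in nhds 0. \<phi> t = \<psi> (\<sigma> t)"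
    using local_coordinate_reparametrize[OF \<phi>(1) \<psi> assms(2)] by blast
  have "\<forall>\<^sub>F t in nhds 0. dist_sq u (\<phi> t) = dist_sq u (\<psi> (\<sigma> t))"
    using \<sigma>(4) by eventually_elim simp
  from analytic_reparametrize(1)[OF \<sigma>(1-3) dist_sq_analytic[OF \<psi>] this] \<phi>(2) \<sigma>(3)
  show "deriv (\<lambda>t. dist_sq u (\<psi> t)) 0 = 0"
    by simp
qed (use assms in \<open>auto simp: critical_point_def\<close>)

text \<open>Any two charts at \<open>p\<close> differ by a reparametrization and therefore yield the
  same order, so the definite description in \<open>milnor\<close> has a unique solution.\<close>

lemma milnor_eq_zorder:
  assumes p: "eval2 (partial_y F) p \<noteq> 0" and \<psi>: "local_coordinate F p \<psi>"
    and nz: "\<forall>\<^sub>F t in at 0. deriv (\<lambda>t. dist_sq u (\<psi> t)) t \<noteq> 0"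
  shows "milnor F u p = zorder (deriv (\<lambda>t. dist_sq u (\<psi> t))) 0"
  unfolding milnor_def
proof (rule the_equality)
  fix n assume "\<exists>\<phi>. local_coordinate F p \<phi> \<and> zorder (deriv (\<lambda>t. dist_sq u (\<phi> t))) 0 = n"
  then obtain \<phi> where \<phi>: "local_coordinate F p \<phi>" "zorder (deriv (\<lambda>t. dist_sq u (\<phi> t))) 0 = n"
    by blast
  obtain \<sigma> where \<sigma>: "\<sigma> analytic_on {0}" "\<sigma> 0 = 0" "deriv \<sigma> 0 \<noteq> 0" "\<forall>\<^sub>F t in nhds 0. \<phi> t = \<psi> (\<sigma> t)"
    using local_coordinate_reparametrize[OF \<phi>(1) \<psi> p] by blast
  have "\<forall>\<^sub>F t in nhds 0. dist_sq u (\<phi> t) = dist_sq u (\<psi> (\<sigma> t))"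
    using \<sigma>(4) by eventually_elim simp
  from analytic_reparametrize(2)[OF \<sigma>(1-3) dist_sq_analytic[OF \<psi>] this nz] \<phi>(2)
  show "n = zorder (deriv (\<lambda>t. dist_sq u (\<psi> t))) 0"
    by simp
qed (use \<psi> in blast)

text \<open>A nonzero second derivative means that the first derivative has a simple zero.\<close>

lemma milnor_morse_point:
  assumes p: "eval2 (partial_y F) p \<noteq> 0" and morse: "morse_point F u p"
  shows "milnor F u p = 1"
proof -
  obtain \<phi> where \<phi>: "local_coordinate F p \<phi>" "deriv (\<lambda>t. dist_sq u (\<phi> t)) 0 = 0"
      "deriv (deriv (\<lambda>t. dist_sq u (\<phi> t))) 0 \<noteq> 0"
    using morse by (auto simp: morse_point_def numeral_2_eq_2)
  let ?f = "deriv (\<lambda>t. dist_sq u (\<phi> t))"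
  have an: "?f analytic_on {0}"
    using dist_sq_analytic[OF \<phi>(1)] by (rule analytic_deriv)
  have "\<forall>\<^sub>F t in at 0. ?f t \<noteq> 0"
    using analytic_eventually_neq[OF an \<phi>(3)] \<phi>(2) by simp
  then have "milnor F u p = zorder ?f 0"
    by (rule milnor_eq_zorder[OF p \<phi>(1)])
  also have "\<dots> = 1"
    using \<phi>(2,3) by (intro zorder_zero_eqI'[OF an]) auto
  finally show ?thesis .
qed

lemma morse_point_imp_critical_point: "morse_point F u p \<Longrightarrow> critical_point F u p"
  by (auto simp: morse_point_def critical_point_def)

section \<open>Counting zeros\<close>

lemma holomorphic_finite_zeros_cball:
  assumes f: "f holomorphic_on ball a R" and "\<rho> < R" and w: "w \<in> ball a R" "f w \<noteq> 0"
  shows "finite {z \<in> cball a \<rho>. f z = 0}"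
proof (cases "f constant_on ball a R")
  \<comment> \<open>The compactness argument of the other case requires a nonconstant function; a
    constant one has no zeros because of \<open>w\<close>.\<close>
  case True
  then have "{z \<in> cball a \<rho>. f z = 0} = {}"
    using assms by (fastforce simp: constant_on_def)
  then show ?thesis
    by (simp only: finite.emptyI)
next
  case False
  then show ?thesis
    using assms by (intro holomorphic_compact_finite_zeros[OF f]) auto
qed

text \<open>The value at \<open>w\<close> prevents \<open>f\<close> from vanishing near
  \<open>z\<close>, by the identity theorem, so the zero is isolated and of positive order.\<close>

lemma zorder_pos_at_zero:
  assumes f: "f holomorphic_on ball a R" and w: "w \<in> ball a R" "f w \<noteq> 0"
    and z: "z \<in> ball a R" "f z = 0"
  shows "zorder f z > 0" and "\<forall>\<^sub>F t in at z. f t \<noteq> 0"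
proof -
  have "\<exists>\<^sub>F t in at z. f t \<noteq> 0"
  proof (rule ccontr)
    assume "\<not> ?thesis"
    then have "\<forall>\<^sub>F t in at z. f t = 0"
      by (simp add: not_frequently)
    then have "\<forall>\<^sub>F t in nhds z. f t = 0"
      using z by (simp add: eventually_nhds_conv_at)
    then obtain S where "open S" "z \<in> S" "\<And>t. t \<in> S \<Longrightarrow> f t = 0"
      by (auto simp: eventually_nhds)
    then have "f w = 0"
    proof (intro analytic_continuation_open[of "S \<inter> ball a R" "ball a R" f "\<lambda>_. 0" w])
      show "S \<inter> ball a R \<noteq> {}"
        using \<open>z \<in> S\<close> z by blast
    qed (use \<open>open S\<close> \<open>\<And>t. t \<in> S \<Longrightarrow> f t = 0\<close> f w in auto)
    then show False
      using w by simp
  qed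
  moreover from this show "zorder f z > 0"
    using zorder_pos_iff[OF f open_ball z(1)] z(2) by blast
  moreover have "f analytic_on {z}"
    using f z(1) analytic_at by blast
  ultimately show "\<forall>\<^sub>F t in at z. f t \<noteq> 0"
    using not_essential_frequently_0_imp_eventually_0[of f z] isolated_singularity_at_analytic
      not_essential_analytic by (metis not_eventually not_frequently non_zero_neighbour)
qed

text \<open>Rouche's theorem on the circle of radius \<open>\<rho>\<close>, with the winding numbers
  evaluated: 1 inside, 0 outside, and no zeros on the circle itself.\<close>

lemma Rouche_ball:
  assumes f: "f holomorphic_on ball a R" and g: "g holomorphic_on ball a R"
    and \<rho>: "0 < \<rho>" "\<rho> < R"
    and zero: "f a = 0" "\<And>z. z \<in> ball a R - {a} \<Longrightarrow> f z \<noteq> 0"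
    and less: "\<And>z. z \<in> sphere a \<rho> \<Longrightarrow> norm (g z) < norm (f z)"
  shows "finite {z \<in> ball a \<rho>. f z + g z = 0}"
    and "(\<Sum>z | z \<in> ball a \<rho> \<and> f z + g z = 0. zorder (\<lambda>z. f z + g z) z) = zorder f a"
proof -
  let ?fg = "\<lambda>z. f z + g z"
  have fg: "?fg holomorphic_on ball a R"
    by (intro holomorphic_intros f g)
  have nz: "?fg z \<noteq> 0" if "z \<in> sphere a \<rho>" for z
    using less[OF that] by (metis add_eq_0_iff norm_minus_cancel order_less_irrefl)
  have w: "a + of_real \<rho> \<in> sphere a \<rho>"
    using \<rho> by (auto simp: dist_norm)
  have fin_cball: "finite {z \<in> cball a \<sigma>. ?fg z = 0}" if "\<sigma> < R" for \<sigma>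
    using holomorphic_finite_zeros_cball[OF fg that, of "a + of_real \<rho>"] nz[OF w] \<rho>
    by (auto simp: dist_norm)
  show fin: "finite {z \<in> ball a \<rho>. ?fg z = 0}"
    using fin_cball[OF \<rho>(2)] by (rule finite_subset[rotated]) auto
  \<comment> \<open>Zeros might accumulate at the boundary of the disk of radius \<open>R\<close>; a
    slightly larger disk than that of radius \<open>\<rho>\<close> contains the circle and only
    finitely many zeros.\<close>
  obtain \<sigma> where \<sigma>: "\<rho> < \<sigma>" "\<sigma> < R"
    using dense \<rho>(2) by blast
  have finS: "finite {z \<in> ball a \<sigma>. ?fg z = 0}"
    using fin_cball[OF \<sigma>(2)] by (rule finite_subset[rotated]) auto
  have "z = a" if "z \<in> ball a \<sigma>" "f z = 0" for z
    using zero(2)[of z] that \<sigma> by auto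
  then have zf: "{z \<in> ball a \<sigma>. f z = 0} = {a}"
    using zero(1) \<sigma> \<rho> by auto
  have sub: "ball a \<sigma> \<subseteq> ball a R"
    using \<sigma> by auto
  have outside: "winding_number (circlepath a \<rho>) z = 0" if "z \<notin> cball a \<rho>" for z
    using that \<rho> by (intro winding_number_zero_outside[of _ "cball a \<rho>"]) auto
  have inside: "winding_number (circlepath a \<rho>) z = 1" if "z \<in> ball a \<rho>" for z
    using that by (intro winding_number_circlepath) (auto simp: dist_norm norm_minus_commute)
  have "(\<Sum>z\<in>{z \<in> ball a \<sigma>. ?fg z = 0}. winding_number (circlepath a \<rho>) z * zorder ?fg z)
      = (\<Sum>z\<in>{z \<in> ball a \<sigma>. f z = 0}. winding_number (circlepath a \<rho>) z * zorder f z)"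
  proof (rule Rouche_theorem)
    show "\<forall>z\<in>path_image (circlepath a \<rho>). norm (g z) < norm (f z)"
      using less \<rho> by simp
    show "\<forall>z. z \<notin> ball a \<sigma> \<longrightarrow> winding_number (circlepath a \<rho>) z = 0"
      using outside \<sigma> by auto
    show "path_image (circlepath a \<rho>) \<subseteq> ball a \<sigma>"
      using \<rho> \<sigma> by auto
  qed (use finS zf f g sub in \<open>auto intro: holomorphic_on_subset\<close>)
  also have "\<dots> = zorder f a"
    unfolding zf using inside[of a] \<rho> by simp
  finally have *: "(\<Sum>z\<in>{z \<in> ball a \<sigma>. ?fg z = 0}. winding_number (circlepath a \<rho>) z * zorder ?fg z)
      = zorder f a" .
  have "(\<Sum>z\<in>{z \<in> ball a \<sigma>. ?fg z = 0}. winding_number (circlepath a \<rho>) z * zorder ?fg z)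
      = (\<Sum>z\<in>{z \<in> ball a \<rho>. ?fg z = 0}. of_int (zorder ?fg z))"
  proof (rule sum.mono_neutral_cong_right[OF finS])
    show "\<forall>z\<in>{z \<in> ball a \<sigma>. ?fg z = 0} - {z \<in> ball a \<rho>. ?fg z = 0}.
        winding_number (circlepath a \<rho>) z * zorder ?fg z = 0"
    proof
      fix z assume "z \<in> {z \<in> ball a \<sigma>. ?fg z = 0} - {z \<in> ball a \<rho>. ?fg z = 0}"
      then have "z \<notin> cball a \<rho>"
        using nz[of z] by auto
      then show "winding_number (circlepath a \<rho>) z * zorder ?fg z = 0"
        using outside by simp
    qed
  qed (use \<sigma> inside in auto)
  also have "\<dots> = of_int (\<Sum>z\<in>{z \<in> ball a \<rho>. ?fg z = 0}. zorder ?fg z)"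
    by simp
  \<comment> \<open>Winding numbers are complex, so the count is first obtained in the complex
    numbers and then brought back to the integers.\<close>
  finally have "complex_of_int (\<Sum>z\<in>{z \<in> ball a \<rho>. ?fg z = 0}. zorder ?fg z) = of_int (zorder f a)"
    using * by simp
  then show "(\<Sum>z | z \<in> ball a \<rho> \<and> ?fg z = 0. zorder ?fg z) = zorder f a"
    by (simp only: of_int_eq_iff)
qed

text \<open>On the compact circle \<open>f\<close> is bounded away from 0 and both \<open>g\<close>
  functions are bounded, so small coefficients make the perturbation dominated uniformly.\<close>

lemma Rouche_family:
  assumes f: "f holomorphic_on ball a R" and g: "g\<^sub>1 holomorphic_on ball a R" "g\<^sub>2 holomorphic_on ball a R"
    and \<rho>: "0 < \<rho>" "\<rho> < R"
    and zero: "f a = 0" "\<And>z. z \<in> ball a R - {a} \<Longrightarrow> f z \<noteq> 0"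
    and c: "(c\<^sub>1 \<longlongrightarrow> (0::complex)) F" "(c\<^sub>2 \<longlongrightarrow> 0) F"
  defines "h \<equiv> \<lambda>s z. f z + (c\<^sub>1 s * g\<^sub>1 z + c\<^sub>2 s * g\<^sub>2 z)"
  shows "\<forall>\<^sub>F s in F. finite {z \<in> ball a \<rho>. h s z = 0} \<and>
    (\<Sum>z | z \<in> ball a \<rho> \<and> h s z = 0. zorder (h s) z) = zorder f a \<and>
    (\<forall>z\<in>ball a \<rho>. h s z = 0 \<longrightarrow> zorder (h s) z > 0 \<and> (\<forall>\<^sub>F t in at z. h s t \<noteq> 0))"
proof -
  have sub: "sphere a \<rho> \<subseteq> ball a R"
    using \<rho> by auto
  have cont: "continuous_on (sphere a \<rho>) \<phi>" if "\<phi> holomorphic_on ball a R" for \<phi>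
    using holomorphic_on_imp_continuous_on[OF that] sub by (rule continuous_on_subset)
  have ne: "sphere a \<rho> \<noteq> {}"
    using \<rho> by simp
  obtain w where w: "w \<in> sphere a \<rho>" "\<And>z. z \<in> sphere a \<rho> \<Longrightarrow> norm (f w) \<le> norm (f z)"
    using continuous_attains_inf[OF compact_sphere ne continuous_on_norm[OF cont[OF f]]] by blast
  obtain z\<^sub>1 where z1: "\<And>z. z \<in> sphere a \<rho> \<Longrightarrow> norm (g\<^sub>1 z) \<le> norm (g\<^sub>1 z\<^sub>1)"
    using continuous_attains_sup[OF compact_sphere ne continuous_on_norm[OF cont[OF g(1)]]] by blast
  obtain z\<^sub>2 where z2: "\<And>z. z \<in> sphere a \<rho> \<Longrightarrow> norm (g\<^sub>2 z) \<le> norm (g\<^sub>2 z\<^sub>2)"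
    using continuous_attains_sup[OF compact_sphere ne continuous_on_norm[OF cont[OF g(2)]]] by blast
  have pos: "norm (f w) > 0"
    using zero(2)[of w] w(1) \<rho> sub by auto
  have "((\<lambda>s. norm (c\<^sub>1 s) * norm (g\<^sub>1 z\<^sub>1) + norm (c\<^sub>2 s) * norm (g\<^sub>2 z\<^sub>2)) \<longlongrightarrow>
      0 * norm (g\<^sub>1 z\<^sub>1) + 0 * norm (g\<^sub>2 z\<^sub>2)) F"
    by (intro tendsto_intros tendsto_norm_zero c)
  then have "\<forall>\<^sub>F s in F. norm (c\<^sub>1 s) * norm (g\<^sub>1 z\<^sub>1) + norm (c\<^sub>2 s) * norm (g\<^sub>2 z\<^sub>2) < norm (f w)"
    using pos by (intro order_tendstoD(2)) auto
  then show ?thesis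
  proof eventually_elim
    case (elim s)
    let ?g = "\<lambda>z. c\<^sub>1 s * g\<^sub>1 z + c\<^sub>2 s * g\<^sub>2 z"
    have gs: "?g holomorphic_on ball a R" and hs: "h s holomorphic_on ball a R"
      unfolding h_def by (intro holomorphic_intros f g)+
    have less: "norm (?g z) < norm (f z)" if "z \<in> sphere a \<rho>" for z
    proof -
      have "norm (?g z) \<le> norm (c\<^sub>1 s) * norm (g\<^sub>1 z) + norm (c\<^sub>2 s) * norm (g\<^sub>2 z)"
        by (metis norm_mult norm_triangle_ineq)
      also have "\<dots> \<le> norm (c\<^sub>1 s) * norm (g\<^sub>1 z\<^sub>1) + norm (c\<^sub>2 s) * norm (g\<^sub>2 z\<^sub>2)"
        using z1[OF that] z2[OF that] by (intro add_mono mult_left_mono) auto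
      also have "\<dots> < norm (f z)"
        using elim w(2)[OF that] by linarith
      finally show ?thesis .
    qed
    have "h s w \<noteq> 0"
      using less[OF w(1)] unfolding h_def by (metis add_eq_0_iff norm_minus_cancel order_less_irrefl)
    then show ?case
      using Rouche_ball[OF f gs \<rho> zero less] zorder_pos_at_zero[OF hs, of w] w(1) sub \<rho>
      unfolding h_def by (auto simp: subset_iff)
  qed
qed

lemma eventually_in_punctured_ball: "S > 0 \<Longrightarrow> \<forall>\<^sub>F t in at 0. t \<in> ball 0 S - {0::complex}"
  using eventually_at_in_open[of "ball 0 S" "0::complex"] by simp

text \<open>Away from 0 the power of the parameter is a unit, so it does not affect orders.\<close>

lemma zorder_power_mult:
  fixes f :: "complex \<Rightarrow> complex" and k :: nat
  assumes "f analytic_on {t}" "t \<noteq> 0" "\<forall>\<^sub>F s in at t. f s \<noteq> 0"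
  shows "zorder (\<lambda>s. s ^ k * f s) t = zorder f t"
proof -
  have "\<forall>\<^sub>F s in at t. s \<noteq> 0"
    using assms(2) by (intro eventually_neq_at_within)
  then have "\<forall>\<^sub>F s in at t. s ^ k * f s \<noteq> 0"
    using assms(3) by eventually_elim simp
  then have "zorder (\<lambda>s. s ^ k * f s) t = zorder (\<lambda>s. s ^ k) t + zorder f t"
    using assms(1) by (intro zorder_times_analytic analytic_intros)
  also have "zorder (\<lambda>s. s ^ k) t = 0"
    using assms(2) by (intro zorder_eq_0I analytic_intros) auto
  finally show ?thesis
    by simp
qed

section \<open>Branches at isotropic points\<close>

locale isotropic_branch =
  fixes F :: "complex poly poly" and \<Gamma> :: "cp2 set" and \<xi> :: cp2
    and r :: real and P Q :: "complex \<Rightarrow> complex" and k :: nat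
  assumes squarefree: "squarefree F"
    and isotropic: "\<xi> \<in> Q_inf"
    and branch: "branch_parametrization F \<Gamma> \<xi> r P Q k"
begin

definition \<gamma> :: "complex \<Rightarrow> point" where
  "\<gamma> t = (P t / t ^ k, Q t / t ^ k)"

text \<open>
  \<open>a\<close> and \<open>b\<close> are the derivatives of the coordinates of \<open>\<gamma>\<close>, multiplied by \<open>t ^ (k + 1)\<close>.
  Since the first coordinate has a pole, \<open>a 0 \<noteq> 0\<close>.
\<close>

definition a :: "complex \<Rightarrow> complex" where
  "a t = t * deriv P t - of_nat k * P t"

definition b :: "complex \<Rightarrow> complex" where
  "b t = t * deriv Q t - of_nat k * Q t"

lemma r: "r > 0"
  and holo: "P holomorphic_on ball 0 r" "Q holomorphic_on ball 0 r"
  and subset: "\<Gamma> \<subseteq> proj_closure F"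
  and at_0: "branch_map P Q k 0 = \<xi>"
  using branch by (auto simp: branch_parametrization_def)

text \<open>At an isotropic point \<open>x = 0\<close> would force \<open>y = 0\<close>, so the
  first homogeneous coordinate is nonzero. The last one, \<open>0 ^ k\<close>, must vanish, which
  excludes \<open>k = 0\<close> because \<open>0 ^ 0 = 1\<close>.\<close>

lemma P_0: "P 0 \<noteq> 0" and k_pos: "k > 0"
proof -
  obtain x y where xy: "\<xi> = cp2_of x y 0" "(x, y) \<noteq> (0, 0)" "x\<^sup>2 + y\<^sup>2 = 0"
    using isotropic by (auto simp: Q_inf_def)
  have "x \<noteq> 0"
    using xy(2,3) by auto
  have "cp2_of x y 0 = cp2_of (P 0) (Q 0) (0 ^ k)"
    using at_0 xy(1) by (simp add: branch_map_def)
  then obtain c where "c \<noteq> 0" "P 0 = c * x" "0 ^ k = c * 0"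
    using xy(2) branch by (subst (asm) cp2_of_eq_iff) (auto simp: branch_parametrization_def)
  then show "P 0 \<noteq> 0" "k > 0"
    using \<open>x \<noteq> 0\<close> by (auto intro: gr0I)
qed

lemma holo_ab: "a holomorphic_on ball 0 r" "b holomorphic_on ball 0 r"
  unfolding a_def b_def by (intro holomorphic_intros holo open_ball)+

lemma a_0: "a 0 \<noteq> 0"
  using P_0 k_pos by (simp add: a_def)

lemma branch_map_eq_aff: "t \<noteq> 0 \<Longrightarrow> branch_map P Q k t = aff (\<gamma> t)"
  by (simp add: branch_map_def \<gamma>_def cp2_of_eq_aff)

lemma \<xi>_neq_aff: "\<xi> \<noteq> aff p"
  using P_0 k_pos cp2_of_eq_aff_iff[of "P 0" "Q 0" "0 ^ k" p] by (simp add: at_0[symmetric] branch_map_def)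

lemma branch_map_inj: "inj_on (branch_map P Q k) (ball 0 r)"
  and branch_map_image: "branch_map P Q k ` ball 0 r = \<Gamma>"
  and branch_map_continuous: "continuous_on (ball 0 r) (branch_map P Q k)"
proof -
  obtain g where "homeomorphism (ball 0 r) \<Gamma> (branch_map P Q k) g"
    using branch by (auto simp: branch_parametrization_def)
  then show "inj_on (branch_map P Q k) (ball 0 r)" "branch_map P Q k ` ball 0 r = \<Gamma>"
    "continuous_on (ball 0 r) (branch_map P Q k)"
    unfolding homeomorphism_def by (metis inj_on_inverseI)+
qed

lemma \<gamma>_in_curve: "t \<in> ball 0 r \<Longrightarrow> t \<noteq> 0 \<Longrightarrow> \<gamma> t \<in> curve F"
  using branch_map_image branch_map_eq_aff[of t] subset aff_in_proj_closure_iff by (metis image_eqI subsetD)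

lemma \<gamma>_inj: "inj_on \<gamma> (ball 0 r - {0})"
  using branch_map_inj branch_map_eq_aff unfolding inj_on_def by (metis DiffD1 DiffD2 singletonI)

text \<open>The centre of the disk drops out because it is sent to \<open>\<xi>\<close>, which is
  not an affine point.\<close>

lemma aff_in_branch_iff: "aff p \<in> \<Gamma> \<longleftrightarrow> (\<exists>t\<in>ball 0 r - {0}. p = \<gamma> t)"
proof
  assume "aff p \<in> \<Gamma>"
  then obtain t where t: "t \<in> ball 0 r" "aff p = branch_map P Q k t"
    using branch_map_image by blast
  then have "t \<noteq> 0"
    using at_0 \<xi>_neq_aff by metis
  then show "\<exists>t\<in>ball 0 r - {0}. p = \<gamma> t"
    using t branch_map_eq_aff by auto
next
  assume "\<exists>t\<in>ball 0 r - {0}. p = \<gamma> t"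
  then show "aff p \<in> \<Gamma>"
    using branch_map_image branch_map_eq_aff by (metis DiffE imageI singletonI)
qed

lemma holo_\<gamma>:
  "(\<lambda>t. fst (\<gamma> t)) holomorphic_on ball 0 r - {0}" "(\<lambda>t. snd (\<gamma> t)) holomorphic_on ball 0 r - {0}"
  unfolding \<gamma>_def fst_conv snd_conv
  by (auto intro!: holomorphic_intros intro: holomorphic_on_subset[OF holo(1)] holomorphic_on_subset[OF holo(2)])

lemma quotient_power_derivative:
  assumes "f holomorphic_on ball 0 r" "t \<in> ball 0 r" "t \<noteq> 0"
  shows "((\<lambda>t. f t / t ^ k) has_field_derivative (t * deriv f t - of_nat k * f t) / t ^ (k + 1)) (at t)"
proof -
  have f: "(f has_field_derivative deriv f t) (at t)"
    using assms holomorphic_derivI open_ball by blast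
  have p: "((\<lambda>t. t ^ k) has_field_derivative of_nat k * t ^ (k - 1)) (at t)"
    by (auto intro!: derivative_eq_intros)
  have "t ^ k = t * t ^ (k - 1)"
    using k_pos by (simp add: power_eq_if)
  then have "(deriv f t * t ^ k - f t * (of_nat k * t ^ (k - 1))) / (t ^ k * t ^ k)
      = (t * deriv f t - of_nat k * f t) / t ^ (k + 1)"
    using assms(3) by (simp add: field_simps)
  with DERIV_divide[OF f p] assms(3) show ?thesis
    by simp
qed

lemma \<gamma>_derivative:
  assumes "t \<in> ball 0 r" "t \<noteq> 0"
  shows "((\<lambda>t. fst (\<gamma> t)) has_field_derivative a t / t ^ (k + 1)) (at t)"
    and "((\<lambda>t. snd (\<gamma> t)) has_field_derivative b t / t ^ (k + 1)) (at t)"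
  using quotient_power_derivative[OF holo(1) assms] quotient_power_derivative[OF holo(2) assms]
  by (simp_all add: \<gamma>_def a_def b_def)

lemma holomorphic_eventually_neq_0:
  assumes "f holomorphic_on ball 0 r" "f 0 \<noteq> 0"
  shows "\<forall>\<^sub>F t in at 0. f t \<noteq> 0"
proof -
  have "continuous_on (ball 0 r) f"
    using assms(1) by (rule holomorphic_on_imp_continuous_on)
  then have "isCont f 0"
    using r by (simp add: continuous_on_eq_continuous_at)
  then show ?thesis
    using assms(2) unfolding isCont_def by (rule tendsto_imp_eventually_ne)
qed

lemma eventually_a_neq_0: "\<forall>\<^sub>F t in at 0. a t \<noteq> 0"
  using holomorphic_eventually_neq_0[OF holo_ab(1) a_0] .

text \<open>The function is meromorphic at 0, so near 0 it is either identically zero or nowhere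
  zero off the centre. The first case contradicts \<open>partial_y_not_identically_0\<close> on a
  punctured disk, which is connected. Thus near \<open>\<xi>\<close> the affine part of the branch
  is regular and locally a graph over \<open>x\<close>.\<close>

lemma eventually_partial_y_neq_0: "\<forall>\<^sub>F t in at 0. eval2 (partial_y F) (\<gamma> t) \<noteq> 0"
proof -
  have an: "P analytic_on {0}" "Q analytic_on {0}"
    using holo r analytic_at by (metis centre_in_ball open_ball)+
  have mero: "(\<lambda>t. eval2 (partial_y F) (P t / t ^ k, Q t / t ^ k)) meromorphic_on {0}"
    using an by (intro eval2_meromorphic_on meromorphic_intros) (auto intro: analytic_on_imp_meromorphic_on)
  have "\<not> (\<forall>\<^sub>F t in at 0. eval2 (partial_y F) (\<gamma> t) = 0)"
  proof
    assume "\<forall>\<^sub>F t in at 0. eval2 (partial_y F) (\<gamma> t) = 0"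
    then have "\<forall>\<^sub>F t in at 0. eval2 (partial_y F) (\<gamma> t) = 0 \<and> a t \<noteq> 0"
      using eventually_a_neq_0 by eventually_elim simp
    then obtain \<rho> where \<rho>: "\<rho> > 0"
        "\<And>t. t \<noteq> 0 \<Longrightarrow> dist t 0 < \<rho> \<Longrightarrow> eval2 (partial_y F) (\<gamma> t) = 0 \<and> a t \<noteq> 0"
      by (auto simp: eventually_at)
    define S where "S = ball 0 (min r \<rho>) - {0::complex}"
    have S: "open S" "connected S" "S \<subseteq> ball 0 r - {0}"
      using connected_punctured_ball[of "0::complex"] by (auto simp: S_def)
    \<comment> \<open>A constant first coordinate would have derivative 0, whereas this derivative
      is \<open>a t / t ^ (k + 1)\<close> with \<open>a t\<close> nonzero.\<close>
    have nonconst: "\<not> (\<lambda>t. fst (\<gamma> t)) constant_on S"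
    proof
      assume "(\<lambda>t. fst (\<gamma> t)) constant_on S"
      then obtain c where c: "\<And>t. t \<in> S \<Longrightarrow> fst (\<gamma> t) = c"
        by (auto simp: constant_on_def)
      define t :: complex where "t = of_real (min r \<rho> / 2)"
      have t: "t \<in> S"
        using r \<rho>(1) by (auto simp: t_def S_def)
      have "((\<lambda>t. fst (\<gamma> t)) has_field_derivative 0) (at t)"
        using has_field_derivative_transform_within_open[OF DERIV_const S(1) t, of c] c by metis
      moreover have "t \<in> ball 0 r" "t \<noteq> 0"
        using t S(3) by auto
      ultimately have "a t / t ^ (k + 1) = 0"
        using \<gamma>_derivative(1) DERIV_unique by blast
      then show False
        using \<rho>(2)[of t] t by (auto simp: S_def)
    qed
    have "\<exists>t\<in>S. eval2 (partial_y F) (fst (\<gamma> t), snd (\<gamma> t)) \<noteq> 0"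
    proof (rule partial_y_not_identically_0[OF squarefree S(1,2) _ _ nonconst])
      fix t assume "t \<in> S"
      then show "eval2 F (fst (\<gamma> t), snd (\<gamma> t)) = 0"
        using \<gamma>_in_curve[of t] subsetD[OF S(3)] by (auto simp: curve_def)
    qed (use holo_\<gamma> S(3) in \<open>auto intro: holomorphic_on_subset\<close>)
    then show False
      using \<rho>(2) by (auto simp: S_def)
  qed
  then show ?thesis
    using mero not_essential_frequently_0_imp_eventually_0 meromorphic_on_isolated_singularity
      meromorphic_on_not_essential unfolding \<gamma>_def[symmetric]
    by (metis not_eventually not_frequently non_zero_neighbour singletonI)
qed

text \<open>The pulled-back local equation is \<open>t ^ k / P t\<close>, and \<open>P\<close> is a
  unit at 0.\<close>

lemma multiplicity: "mult_at_infinity (branch_map P Q k) = int k"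
proof -
  have "\<forall>\<^sub>F t in at 0. P t \<noteq> 0"
    using holomorphic_eventually_neq_0[OF holo(1) P_0] .
  then have "\<forall>\<^sub>F t in at 0. z_over_x (branch_map P Q k t) = inverse (P t) * (t - 0) ^ k"
    by eventually_elim (auto simp: branch_map_def z_over_x_cp2_of divide_inverse)
  then have "mult_at_infinity (branch_map P Q k) = zorder (\<lambda>t. inverse (P t) * (t - 0) ^ k) 0"
    unfolding mult_at_infinity_def by (rule zorder_cong) simp
  also have "\<dots> = int k"
  proof -
    obtain e where e: "e > 0" "\<And>t. t \<noteq> 0 \<Longrightarrow> dist t 0 < e \<Longrightarrow> P t \<noteq> 0"
      using \<open>\<forall>\<^sub>F t in at 0. P t \<noteq> 0\<close> by (auto simp: eventually_at)
    have nz: "P t \<noteq> 0" if "t \<in> ball 0 (min r e)" for t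
      using that e(2)[of t] P_0 by (cases "t = 0") auto
    show ?thesis
    proof (rule zorder_eqI[of "ball 0 (min r e)" _ "\<lambda>t. inverse (P t)"])
      show "(\<lambda>t. inverse (P t)) holomorphic_on ball 0 (min r e)"
        using nz by (intro holomorphic_intros holomorphic_on_subset[OF holo(1)]) auto
    qed (use r e(1) P_0 in auto)
  qed
  finally show ?thesis .
qed


section \<open>The function \<open>h\<close> and the critical points on the branch\<close>

definition h :: "point \<Rightarrow> complex \<Rightarrow> complex" where
  "h u t = h_fun P Q k t u"

lemma h_expand: "h u t = a t * (P t - fst u * t ^ k) + b t * (Q t - snd u * t ^ k)"
  by (simp add: h_def h_fun_def a_def b_def)

text \<open>
  The dependence on \<open>u\<close> starts in degree \<open>k\<close>: the coefficients \<open>h\<^sub>j\<close> with \<open>j < k\<close> are constants.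
\<close>

lemma h_diff: "h u t = h v t + t ^ k * ((fst v - fst u) * a t + (snd v - snd u) * b t)"
  by (simp add: h_expand algebra_simps)

lemma holo_h: "h u holomorphic_on ball 0 r"
  unfolding h_expand by (intro holomorphic_intros holo holo_ab)

text \<open>One factor \<open>t ^ k\<close> of the denominator comes from the coordinates of
  \<open>\<gamma>\<close>, the factor \<open>t ^ (k + 1)\<close> from their derivatives. Off the
  centre the denominator is a unit, so \<open>h\<close> has the zeros of this derivative, with the
  same orders.\<close>

lemma dist_sq_derivative:
  assumes "t \<in> ball 0 r" "t \<noteq> 0"
  shows "((\<lambda>t. dist_sq u (\<gamma> t)) has_field_derivative 2 * h u t / t ^ (2 * k + 1)) (at t)"
proof -
  have "((\<lambda>t. dist_sq u (\<gamma> t)) has_field_derivative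
      2 * (fst (\<gamma> t) - fst u) * (a t / t ^ (k + 1)) + 2 * (snd (\<gamma> t) - snd u) * (b t / t ^ (k + 1))) (at t)"
    unfolding dist_sq_def
    by (rule derivative_eq_intros \<gamma>_derivative[OF assms] refl)+ (simp add: diff_divide_distrib algebra_simps)
  moreover have "2 * (p / t ^ k - c) * (d / t ^ (k + 1)) = 2 * (d * (p - c * t ^ k)) / t ^ (2 * k + 1)" for p c d
  proof -
    have "p / t ^ k - c = (p - c * t ^ k) / t ^ k"
      using assms(2) by (simp add: diff_divide_distrib)
    moreover have "t ^ (2 * k + 1) = t ^ k * t ^ (k + 1)"
      by (simp add: mult_2 flip: power_add)
    ultimately show ?thesis
      by (simp only: times_divide_eq_right times_divide_eq_left divide_divide_eq_left mult_ac)
  qed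
  then have "2 * (fst (\<gamma> t) - fst u) * (a t / t ^ (k + 1)) + 2 * (snd (\<gamma> t) - snd u) * (b t / t ^ (k + 1))
      = 2 * h u t / t ^ (2 * k + 1)"
    by (simp only: \<gamma>_def h_expand fst_conv snd_conv distrib_left add_divide_distrib)
  ultimately show ?thesis
    by simp
qed

lemma eventually_add_in_punctured_ball:
  fixes t :: complex
  assumes "t \<in> ball 0 r - {0}"
  shows "\<forall>\<^sub>F s in nhds 0. t + s \<in> ball 0 r - {0}"
proof -
  have "isCont (\<lambda>s. s + t) 0"
    by (intro continuous_intros)
  from topological_tendstoD[OF isCont_tendsto_nhds[OF this], of "ball 0 r - {0}"] assms show ?thesis
    by (simp add: open_delete add.commute)
qed

text \<open>Translating the parameter centres \<open>\<gamma>\<close> at \<open>\<gamma> t\<close>;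
  the condition on \<open>a\<close> makes the first coordinate non-stationary.\<close>

lemma local_coordinate_\<gamma>:
  assumes t: "t \<in> ball 0 r - {0}" and "a t \<noteq> 0"
  shows "local_coordinate F (\<gamma> t) (\<lambda>s. \<gamma> (t + s))"
proof -
  have an: "(\<lambda>t. fst (\<gamma> t)) analytic_on {t}" "(\<lambda>t. snd (\<gamma> t)) analytic_on {t}"
    using holo_\<gamma> t analytic_at open_delete[OF open_ball] by blast+
  have shift: "(\<lambda>s. t + s) analytic_on {0}"
    by (intro analytic_intros)
  have "deriv (\<lambda>s. fst (\<gamma> (t + s))) 0 = a t / t ^ (k + 1)"
    using DERIV_shift[of "\<lambda>t. fst (\<gamma> t)" "a t / t ^ (k + 1)" 0 t] \<gamma>_derivative(1)[of t] t
    by (auto intro!: DERIV_imp_deriv simp: add.commute)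
  then have "deriv (\<lambda>s. fst (\<gamma> (t + s))) 0 \<noteq> 0"
    using assms by simp
  moreover have "\<forall>\<^sub>F s in nhds 0. \<gamma> (t + s) \<in> curve F"
    using eventually_add_in_punctured_ball[OF t] by eventually_elim (auto intro: \<gamma>_in_curve)
  ultimately show ?thesis
    unfolding local_coordinate_def
    using analytic_on_compose[OF shift, of "\<lambda>t. fst (\<gamma> t)"]
      analytic_on_compose[OF shift, of "\<lambda>t. snd (\<gamma> t)"] an by (simp add: o_def)
qed

text \<open>The formula is needed on a whole neighbourhood, not only at the centre, because Milnor
  numbers are orders of the derivative.\<close>

lemma deriv_dist_sq_\<gamma>:
  assumes t: "t \<in> ball 0 r - {0}"
  shows "\<forall>\<^sub>F s in nhds 0. deriv (\<lambda>s. dist_sq u (\<gamma> (t + s))) s = 2 * h u (t + s) / (t + s) ^ (2 * k + 1)"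
  using eventually_add_in_punctured_ball[OF t]
proof eventually_elim
  case (elim s)
  then have "((\<lambda>t. dist_sq u (\<gamma> t)) has_field_derivative 2 * h u (t + s) / (t + s) ^ (2 * k + 1)) (at (t + s))"
    by (intro dist_sq_derivative) auto
  then show ?case
    using DERIV_shift[of "\<lambda>t. dist_sq u (\<gamma> t)" _ s t] by (auto intro!: DERIV_imp_deriv simp: add.commute)
qed

text \<open>The condition on \<open>a\<close> makes the translated \<open>\<gamma>\<close> a chart
  at \<open>\<gamma> t\<close>, and the one on \<open>partial_y F\<close> makes charts there
  comparable by reparametrization.\<close>

definition regular_parameter :: "complex \<Rightarrow> bool" where
  "regular_parameter t \<longleftrightarrow> t \<in> ball 0 r - {0} \<and> a t \<noteq> 0 \<and> eval2 (partial_y F) (\<gamma> t) \<noteq> 0"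

lemma eventually_regular_parameter: "\<forall>\<^sub>F t in at 0. regular_parameter t"
  using eventually_a_neq_0 eventually_partial_y_neq_0 eventually_in_punctured_ball[OF r]
  by eventually_elim (simp add: regular_parameter_def)

lemma regular_parameter_in_regular_part: "regular_parameter t \<Longrightarrow> \<gamma> t \<in> regular_part F"
  using \<gamma>_in_curve[of t] by (simp add: regular_parameter_def regular_part_def)

lemma critical_point_\<gamma>_iff:
  assumes "regular_parameter t"
  shows "critical_point F u (\<gamma> t) \<longleftrightarrow> h u t = 0"
proof -
  have t: "t \<in> ball 0 r - {0}" "a t \<noteq> 0" "eval2 (partial_y F) (\<gamma> t) \<noteq> 0"
    using assms by (auto simp: regular_parameter_def)
  have "critical_point F u (\<gamma> t) \<longleftrightarrow> deriv (\<lambda>s. dist_sq u (\<gamma> (t + s))) 0 = 0"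
    using regular_parameter_in_regular_part[OF assms] t(3) local_coordinate_\<gamma>[OF t(1,2)]
    by (rule critical_point_iff)
  also have "\<dots> \<longleftrightarrow> h u t = 0"
    using eventually_nhds_x_imp_x[OF deriv_dist_sq_\<gamma>[OF t(1)]] t(1) by simp
  finally show ?thesis .
qed

text \<open>In the translated chart the derivative of the distance is \<open>h\<close> times the
  unit \<open>2 / s ^ (2 * k + 1)\<close>.\<close>

lemma milnor_\<gamma>:
  assumes t: "regular_parameter t" and nz: "\<forall>\<^sub>F s in at t. h u s \<noteq> 0"
  shows "milnor F u (\<gamma> t) = zorder (h u) t"
proof -
  have t': "t \<in> ball 0 r - {0}" "a t \<noteq> 0" "eval2 (partial_y F) (\<gamma> t) \<noteq> 0"
    using t by (auto simp: regular_parameter_def)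
  let ?d = "deriv (\<lambda>s. dist_sq u (\<gamma> (t + s)))" and ?e = "\<lambda>s. 2 * h u (t + s) / (t + s) ^ (2 * k + 1)"
  have eq: "\<forall>\<^sub>F s in at 0. ?d s = ?e s"
    using deriv_dist_sq_\<gamma>[OF t'(1), of u] unfolding eventually_at_filter by (rule eventually_mono) simp
  have ne: "\<forall>\<^sub>F s in at 0. t + s \<noteq> 0"
    using eventually_add_in_punctured_ball[OF t'(1)] by (auto simp: eventually_at_filter elim: eventually_mono)
  have nz': "\<forall>\<^sub>F s in at 0. h u (t + s) \<noteq> 0"
    using nz by (simp add: at_to_0' eventually_filtermap add.commute)
  have "\<forall>\<^sub>F s in at 0. ?d s \<noteq> 0"
    using eq ne nz' by eventually_elim simp
  then have "milnor F u (\<gamma> t) = zorder ?d 0"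
    by (rule milnor_eq_zorder[OF t'(3) local_coordinate_\<gamma>[OF t'(1,2)]])
  also have "\<dots> = zorder ?e 0"
    using eq by (rule zorder_cong) simp
  also have "\<dots> = zorder (\<lambda>s. 2 * h u s / s ^ (2 * k + 1)) t"
    by (subst (2) zorder_shift) (simp add: add.commute)
  also have "\<dots> = zorder (\<lambda>s. h u s * (2 / s ^ (2 * k + 1))) t"
    by (simp add: field_simps)
  also have "\<dots> = zorder (h u) t + zorder (\<lambda>s. 2 / s ^ (2 * k + 1)) t"
  proof (rule zorder_times_analytic)
    show "h u analytic_on {t}"
      using holo_h t'(1) analytic_at by blast
    show "(\<lambda>s. 2 / s ^ (2 * k + 1)) analytic_on {t}"
      using t'(1) by (intro analytic_intros) auto
    have "\<forall>\<^sub>F s in at t. s \<noteq> 0"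
      using t'(1) by (intro eventually_neq_at_within)
    then show "\<forall>\<^sub>F s in at t. h u s * (2 / s ^ (2 * k + 1)) \<noteq> 0"
      using nz by eventually_elim simp
  qed
  also have "zorder (\<lambda>s. 2 / s ^ (2 * k + 1)) t = 0"
    using t'(1) by (intro zorder_eq_0I analytic_intros) auto
  finally show ?thesis
    by simp
qed

text \<open>Differentiate the vanishing of \<open>F\<close> along \<open>\<gamma>\<close> and clear
  the common denominator \<open>t ^ (k + 1)\<close>.\<close>

lemma tangent_\<gamma>:
  assumes t: "t \<in> ball 0 r - {0}"
  shows "(a t, b t) \<in> tangent_space F (\<gamma> t)"
proof -
  let ?d = "eval2 (partial_x F) (\<gamma> t) * (a t / t ^ (k + 1)) + eval2 (partial_y F) (\<gamma> t) * (b t / t ^ (k + 1))"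
  have "((\<lambda>t. eval2 F (fst (\<gamma> t), snd (\<gamma> t))) has_field_derivative ?d) (at t)"
    using eval2_has_field_derivative[OF \<gamma>_derivative, of t F] t by simp
  moreover have "((\<lambda>t. eval2 F (fst (\<gamma> t), snd (\<gamma> t))) has_field_derivative 0) (at t)"
  proof (rule has_field_derivative_transform_within_open[OF DERIV_const])
    show "open (ball 0 r - {0::complex})" "t \<in> ball 0 r - {0}"
      using t by auto
    show "0 = eval2 F (fst (\<gamma> s), snd (\<gamma> s))" if "s \<in> ball 0 r - {0}" for s
      using \<gamma>_in_curve[of s] that by (simp add: curve_def)
  qed
  ultimately have "?d = 0"
    by (rule DERIV_unique)
  moreover have "?d = (eval2 (partial_x F) (\<gamma> t) * a t + eval2 (partial_y F) (\<gamma> t) * b t) / t ^ (k + 1)"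
    by (simp only: times_divide_eq_right add_divide_distrib)
  ultimately show ?thesis
    using t by (simp add: tangent_space_def)
qed

text \<open>Orthogonality at \<open>\<gamma> (t n)\<close>, tested on the tangent vector
  \<open>(a, b)\<close>, says that \<open>h (v n) (t n) = 0\<close>. By \<open>h_diff\<close> the
  quotient for the limit centre is then a combination of \<open>a\<close> and \<open>b\<close> whose
  coefficients tend to 0.\<close>

lemma atypical_sequence:
  assumes "u\<^sub>0 \<in> atypical_discriminant F \<Gamma> \<xi>"
  obtains t where "\<And>n. t n \<in> ball 0 r - {0}" "t \<longlonglongrightarrow> 0" "(\<lambda>n. h u\<^sub>0 (t n) / t n ^ k) \<longlonglongrightarrow> 0"
proof -
  obtain v p where v: "v \<longlonglongrightarrow> u\<^sub>0" and lim: "(\<lambda>n. aff (p n)) \<longlonglongrightarrow> \<xi>"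
    and p: "\<And>n. aff (p n) \<in> \<Gamma>" "\<And>n w. w \<in> tangent_space F (p n) \<Longrightarrow> bilin (v n - p n) w = 0"
    using assms unfolding atypical_discriminant_def by blast
  have "\<exists>t. t \<in> ball 0 r - {0} \<and> p n = \<gamma> t" for n
    using p(1)[of n] aff_in_branch_iff by blast
  then obtain t where t: "\<And>n. t n \<in> ball 0 r - {0}" "\<And>n. p n = \<gamma> (t n)"
    by metis
  obtain g where g: "homeomorphism (ball 0 r) \<Gamma> (branch_map P Q k) g"
    using branch by (auto simp: branch_parametrization_def)
  have inv: "g (branch_map P Q k s) = s" if "s \<in> ball 0 r" for s
    using g that by (simp add: homeomorphism_def)
  \<comment> \<open>Continuity of the inverse parametrization converts convergence to
    \<open>\<xi>\<close> into convergence of the parameters to 0.\<close>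
  have "(\<lambda>n. g (aff (p n))) \<longlonglongrightarrow> g \<xi>"
  proof (rule continuous_on_tendsto_compose[OF _ lim])
    show "continuous_on \<Gamma> g"
      using g by (simp add: homeomorphism_def)
    show "\<xi> \<in> \<Gamma>"
      using at_0 branch_map_image r by force
  qed (use p(1) in auto)
  moreover have "g (aff (p n)) = t n" for n
    using t inv[of "t n"] by (simp add: branch_map_eq_aff)
  moreover have "g \<xi> = 0"
    using inv[of 0] r at_0 by simp
  ultimately have t0: "t \<longlonglongrightarrow> 0"
    by simp
  have "h (v n) (t n) = 0" for n
  proof -
    have "bilin (v n - \<gamma> (t n)) (a (t n), b (t n)) = 0"
      using p(2)[of "(a (t n), b (t n))" n] tangent_\<gamma>[OF t(1)] t(2) by simp
    then have "t n ^ k * ((fst (v n) - P (t n) / t n ^ k) * a (t n) + (snd (v n) - Q (t n) / t n ^ k) * b (t n)) = 0"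
      by (simp add: bilin_def \<gamma>_def)
    moreover have *: "t n ^ k * ((x - y / t n ^ k) * c) = - (c * (y - x * t n ^ k))" for x y c
      using t(1)[of n] by (simp add: field_simps)
    have "t n ^ k * ((fst (v n) - P (t n) / t n ^ k) * a (t n) + (snd (v n) - Q (t n) / t n ^ k) * b (t n))
        = - h (v n) (t n)"
      by (simp only: distrib_left * h_expand minus_add_distrib)
    ultimately show ?thesis
      by simp
  qed
  then have eq: "h u\<^sub>0 (t n) / t n ^ k = (fst (v n) - fst u\<^sub>0) * a (t n) + (snd (v n) - snd u\<^sub>0) * b (t n)" for n
    using h_diff[of u\<^sub>0 "t n" "v n"] t(1)[of n] by simp
  have "(\<lambda>n. f (t n)) \<longlonglongrightarrow> f 0" if "f holomorphic_on ball 0 r" for f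
  proof (rule continuous_on_tendsto_compose[OF _ t0])
    show "continuous_on (ball 0 r) f"
      using that by (rule holomorphic_on_imp_continuous_on)
  qed (use r t(1) in auto)
  note ab = this[OF holo_ab(1)] this[OF holo_ab(2)]
  have "(\<lambda>n. h u\<^sub>0 (t n) / t n ^ k) \<longlonglongrightarrow> (fst u\<^sub>0 - fst u\<^sub>0) * a 0 + (snd u\<^sub>0 - snd u\<^sub>0) * b 0"
    unfolding eq by (intro tendsto_intros v ab)
  then have "(\<lambda>n. h u\<^sub>0 (t n) / t n ^ k) \<longlonglongrightarrow> 0"
    by simp
  with t(1) t0 show ?thesis
    by (rule that)
qed

section \<open>The power series of \<open>h\<close> at the centre of the branch\<close>

lemma h_coeff_eq: "h_coeff P Q k j u = fps_nth (fps_expansion (h u) 0) j"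
  by (simp add: h_coeff_def h_def[abs_def])

lemma h_has_fps_expansion: "h u has_fps_expansion fps_expansion (h u) 0"
  using holo_h r by (intro analytic_at_imp_has_fps_expansion_0) (metis analytic_at centre_in_ball open_ball)

lemma h_factorization:
  assumes atyp: "u\<^sub>0 \<in> atypical_discriminant F \<Gamma> \<xi>" and tail: "h_tail P Q k u\<^sub>0 \<noteq> 0"
  obtains T R where "0 < R" "R \<le> r" "T holomorphic_on ball 0 R" "T 0 = 0"
    "\<And>t. t \<in> ball 0 R - {0} \<Longrightarrow> T t \<noteq> 0" "\<And>t. t \<in> ball 0 R \<Longrightarrow> h u\<^sub>0 t = t ^ k * T t"
    "zorder T 0 = m_branch P Q k u\<^sub>0" "m_branch P Q k u\<^sub>0 > 0"
proof -
  let ?E = "fps_expansion (h u\<^sub>0) 0"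
  have E: "?E \<noteq> 0"
  proof
    assume "?E = 0"
    then have "h_tail P Q k u\<^sub>0 = 0"
      by (simp add: fps_eq_iff h_tail_def h_coeff_eq)
    then show False
      using tail by simp
  qed
  define N where "N = subdegree ?E"
  have zorder_h: "zorder (h u\<^sub>0) 0 = int N"
    using has_fps_expansion_zorder_0[OF h_has_fps_expansion E] by (simp add: N_def)
  have nz: "\<exists>t\<in>ball 0 r. h u\<^sub>0 t \<noteq> 0"
  proof (rule ccontr)
    assume "\<not> ?thesis"
    then have "\<forall>\<^sub>F t in nhds 0. h u\<^sub>0 t = 0"
      using eventually_nhds_in_open[of "ball 0 r" 0] r by (auto elim: eventually_mono)
    then have "h u\<^sub>0 has_fps_expansion 0 \<longleftrightarrow> (\<lambda>_. 0) has_fps_expansion (0 :: complex fps)"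
      by (rule has_fps_expansion_cong) simp
    then have "?E = 0"
      by (intro fps_expansion_eqI) simp
    then show False
      using E by simp
  qed
  \<comment> \<open>The unit part of \<open>h\<close>: \<open>h\<close> is \<open>t ^ N\<close>
    times the function \<open>G\<close>, which has no zeros near 0.\<close>
  define G where "G = zor_poly (h u\<^sub>0) 0"
  have "\<exists>R>0. cball (0 :: complex) R \<subseteq> ball 0 r \<and> G holomorphic_on cball 0 R \<and>
      (\<forall>t\<in>cball 0 R. h u\<^sub>0 t = G t * t ^ N \<and> G t \<noteq> 0)"
    using zorder_exist_zero[OF holo_h[of u\<^sub>0] open_ball convex_connected[OF convex_ball] _ nz, of 0, THEN conjunct2] r
    by (simp add: zorder_h G_def)
  then obtain R where R: "R > 0" "cball (0 :: complex) R \<subseteq> ball 0 r" "G holomorphic_on cball 0 R"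
      "\<And>t. t \<in> cball 0 R \<Longrightarrow> h u\<^sub>0 t = G t * t ^ N" "\<And>t. t \<in> cball 0 R \<Longrightarrow> G t \<noteq> 0"
    by blast
  obtain t where t: "\<And>n. t n \<in> ball 0 r - {0}" "t \<longlonglongrightarrow> 0" "(\<lambda>n. h u\<^sub>0 (t n) / t n ^ k) \<longlonglongrightarrow> 0"
    using atypical_sequence[OF atyp] by blast
  have N: "k < N"
  proof (rule ccontr)
    assume "\<not> k < N"
    then have le: "N \<le> k"
      by simp
    have near: "\<forall>\<^sub>F n in sequentially. t n \<in> ball 0 R"
      using topological_tendstoD[OF t(2) open_ball, of 0 R] R(1) by simp
    \<comment> \<open>For \<open>N \<le> k\<close> this sequence equals \<open>G (t n)\<close>
      eventually, so it would tend both to 0 and to \<open>G 0\<close>, which is nonzero.\<close>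
    have "(\<lambda>n. h u\<^sub>0 (t n) / t n ^ k * t n ^ (k - N)) \<longlonglongrightarrow> 0 * 0 ^ (k - N)"
      by (intro tendsto_intros t)
    moreover have "\<forall>\<^sub>F n in sequentially. h u\<^sub>0 (t n) / t n ^ k * t n ^ (k - N) = G (t n)"
      using near
    proof eventually_elim
      case (elim n)
      have "t n ^ k = t n ^ N * t n ^ (k - N)"
        using le by (simp flip: power_add)
      then show ?case
        using R(4)[of "t n"] elim t(1)[of n] by simp
    qed
    ultimately have "(\<lambda>n. G (t n)) \<longlonglongrightarrow> 0"
      using tendsto_cong by force
    moreover have "(\<lambda>n. G (t n)) \<longlonglongrightarrow> G 0"
    proof (rule continuous_on_tendsto_compose[OF _ t(2)])
      show "continuous_on (cball 0 R) G"
        using R(3) by (rule holomorphic_on_imp_continuous_on)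
    qed (use R(1) near in \<open>auto elim: eventually_mono\<close>)
    ultimately have "G 0 = 0"
      using LIMSEQ_unique by blast
    then show False
      using R(1,5) by simp
  qed
  \<comment> \<open>As the order exceeds \<open>k\<close>, discarding the degrees up to
    \<open>k\<close> removes only zero coefficients.\<close>
  have "h_tail P Q k u\<^sub>0 = ?E"
  proof (rule fps_ext)
    fix j
    show "fps_nth (h_tail P Q k u\<^sub>0) j = fps_nth ?E j"
      using N nth_less_subdegree_zero[of j ?E] by (auto simp: h_tail_def h_coeff_eq N_def)
  qed
  then have m: "m_branch P Q k u\<^sub>0 = int (N - k)"
    using N by (simp add: m_branch_def multiplicity N_def of_nat_diff)
  define T where "T = (\<lambda>t. G t * t ^ (N - k))"
  have G: "G holomorphic_on ball 0 R"
    using R(3) by (rule holomorphic_on_subset) auto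
  show ?thesis
  proof (rule that[of R T])
    show "R \<le> r"
      using R(1,2) r by (simp add: cball_subset_ball_iff)
    show "T holomorphic_on ball 0 R"
      unfolding T_def by (intro holomorphic_intros G)
    show "h u\<^sub>0 t = t ^ k * T t" if "t \<in> ball 0 R" for t
    proof -
      have "t ^ N = t ^ k * t ^ (N - k)"
        using N by (simp flip: power_add)
      then show ?thesis
        using R(4)[of t] that by (simp add: T_def)
    qed
    show "zorder T 0 = m_branch P Q k u\<^sub>0"
      unfolding m by (rule zorder_eqI[OF open_ball _ G]) (use R(1,5) in \<open>auto simp: T_def\<close>)
  qed (use R N in \<open>auto simp: T_def m\<close>)
qed

text \<open>Multiplication by \<open>t ^ k\<close> shifts the expansion of \<open>H\<close>. This
  turns the hypothesis on the path into the statement that 0 is not a zero of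
  \<open>H\<close>.\<close>

lemma h_coeff_k:
  assumes "0 < R" "H holomorphic_on ball 0 R" "\<And>t. t \<in> ball 0 R \<Longrightarrow> h u t = t ^ k * H t"
  shows "h_coeff P Q k k u = H 0"
proof -
  have "H analytic_on {0}"
    using assms(1,2) analytic_at by (metis centre_in_ball open_ball)
  then have H: "H has_fps_expansion fps_expansion H 0"
    by (rule analytic_at_imp_has_fps_expansion_0)
  have "\<forall>\<^sub>F t in nhds 0. h u t = t ^ k * H t"
    using eventually_nhds_in_open[of "ball 0 R" 0] assms(1,3) by (auto elim: eventually_mono)
  moreover have "(\<lambda>t. t ^ k * H t) has_fps_expansion fps_X ^ k * fps_expansion H 0"
    by (intro fps_expansion_intros H)
  ultimately have "h u has_fps_expansion fps_X ^ k * fps_expansion H 0"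
    by (subst has_fps_expansion_cong[OF _ refl])
  then have "fps_expansion (h u) 0 = fps_X ^ k * fps_expansion H 0"
    by (rule fps_expansion_eqI)
  then show ?thesis
    by (simp add: h_coeff_eq fps_X_power_mult_nth fps_expansion_def)
qed

text \<open>Continuity of the inverse parametrization on \<open>\<Gamma>\<close>: points of the
  branch close to \<open>\<xi>\<close> have small parameters.\<close>

lemma branch_map_neighbourhood:
  assumes "\<rho> > 0"
  obtains U where "open U" "\<xi> \<in> U" "\<And>t. t \<in> ball 0 r \<Longrightarrow> branch_map P Q k t \<in> U \<Longrightarrow> t \<in> ball 0 \<rho>"
proof -
  obtain g where g: "homeomorphism (ball 0 r) \<Gamma> (branch_map P Q k) g"
    using branch by (auto simp: branch_parametrization_def)
  have inv: "g (branch_map P Q k s) = s" if "s \<in> ball 0 r" for s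
    using g that by (simp add: homeomorphism_def)
  have "continuous_on \<Gamma> g"
    using g by (simp add: homeomorphism_def)
  then obtain U where U: "open U" "U \<inter> \<Gamma> = g -` ball 0 \<rho> \<inter> \<Gamma>"
    using iffD1[OF continuous_on_open_invariant, rule_format, OF _ open_ball[of 0 \<rho>]] by blast
  have mem: "branch_map P Q k t \<in> U \<longleftrightarrow> t \<in> ball 0 \<rho>" if "t \<in> ball 0 r" for t
  proof -
    have "branch_map P Q k t \<in> \<Gamma>"
      using that branch_map_image by blast
    then have "branch_map P Q k t \<in> U \<longleftrightarrow> g (branch_map P Q k t) \<in> ball 0 \<rho>"
      using U(2) by blast
    then show ?thesis
      by (simp only: inv[OF that])
  qed
  show ?thesis
  proof (rule that[of U])
    show "\<xi> \<in> U"
      using mem[of 0] r assms at_0 by simp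
  qed (use U mem in auto)
qed

text \<open>Continuity of the parametrization itself: small parameters give points close to
  \<open>\<xi>\<close>.\<close>

lemma branch_map_small:
  assumes "open U" "\<xi> \<in> U" "\<rho>\<^sub>0 > 0"
  obtains \<rho> where "0 < \<rho>" "\<rho> \<le> \<rho>\<^sub>0" "\<And>t. t \<in> ball 0 \<rho> \<Longrightarrow> branch_map P Q k t \<in> U"
proof -
  have "open (branch_map P Q k -` U \<inter> ball 0 r)"
    using branch_map_continuous assms(1) by (subst (asm) continuous_on_open_vimage) auto
  moreover have "0 \<in> branch_map P Q k -` U \<inter> ball 0 r"
    using assms(2) r at_0 by simp
  ultimately obtain e where e: "e > 0" "ball 0 e \<subseteq> branch_map P Q k -` U \<inter> ball 0 r"
    using openE by blast
  show ?thesis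
  proof (rule that[of "min e \<rho>\<^sub>0"])
    show "branch_map P Q k t \<in> U" if "t \<in> ball 0 (min e \<rho>\<^sub>0)" for t
      using subsetD[OF e(2), of t] that by simp
  qed (use e(1) assms(3) in auto)
qed


text \<open>\<open>\<gamma>\<close> maps the zeros of \<open>H s\<close> near 0 bijectively onto the
  critical points near \<open>\<xi>\<close>, and orders become Milnor numbers. The condition on
  \<open>partial_y F\<close> is carried along so that \<open>milnor_morse_point\<close> can be
  applied to these points.\<close>

lemma critical_points_near_\<xi>:
  assumes atyp: "u\<^sub>0 \<in> atypical_discriminant F \<Gamma> \<xi>" and tail: "h_tail P Q k u\<^sub>0 \<noteq> 0"
    and u: "\<epsilon> > 0" "continuous_on (ball 0 \<epsilon>) u" "u 0 = u\<^sub>0"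
    and nz: "\<forall>s \<in> ball (0 :: complex) \<epsilon> - {0}. h_coeff P Q k k (u s) \<noteq> 0"
  defines "S \<equiv> \<lambda>U s. {p. critical_point F (u s) p \<and> aff p \<in> \<Gamma> \<inter> U}"
  shows "\<exists>U\<^sub>0. open U\<^sub>0 \<and> \<xi> \<in> U\<^sub>0 \<and> (\<forall>U. open U \<longrightarrow> \<xi> \<in> U \<longrightarrow> U \<subseteq> U\<^sub>0 \<longrightarrow>
    (\<forall>\<^sub>F s in at 0. finite (S U s) \<and> (\<Sum>p\<in>S U s. milnor F (u s) p) = m_branch P Q k u\<^sub>0 \<and>
      (\<forall>p\<in>S U s. eval2 (partial_y F) p \<noteq> 0)))"
proof -
  obtain T R\<^sub>1 where T1: "0 < R\<^sub>1" "R\<^sub>1 \<le> r" "T holomorphic_on ball 0 R\<^sub>1" "T 0 = 0"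
    "\<And>t. t \<in> ball 0 R\<^sub>1 - {0} \<Longrightarrow> T t \<noteq> 0" "\<And>t. t \<in> ball 0 R\<^sub>1 \<Longrightarrow> h u\<^sub>0 t = t ^ k * T t"
    "zorder T 0 = m_branch P Q k u\<^sub>0"
    using h_factorization[OF atyp tail] by metis
  obtain R\<^sub>2 where R2: "R\<^sub>2 > 0" "\<And>t. t \<noteq> 0 \<Longrightarrow> dist t 0 < R\<^sub>2 \<Longrightarrow> regular_parameter t"
    using eventually_regular_parameter by (auto simp: eventually_at)
  \<comment> \<open>On this disk the factorization of \<open>h\<close> holds and every nonzero
    parameter is regular.\<close>
  define R where "R = min R\<^sub>1 R\<^sub>2"
  have R: "0 < R" "R \<le> r" "R \<le> R\<^sub>1"
    using T1(1,2) R2(1) by (auto simp: R_def)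
  have T: "T holomorphic_on ball 0 R" "\<And>t. t \<in> ball 0 R - {0} \<Longrightarrow> T t \<noteq> 0"
    "\<And>t. t \<in> ball 0 R \<Longrightarrow> h u\<^sub>0 t = t ^ k * T t"
    using T1 R by (auto intro: holomorphic_on_subset)
  have reg: "regular_parameter t" if "t \<in> ball 0 R - {0}" for t
    using R2(2)[of t] that by (simp add: R_def)
  have ab: "a holomorphic_on ball 0 R" "b holomorphic_on ball 0 R"
    using holo_ab R(2) by (auto intro: holomorphic_on_subset)
  define c\<^sub>1 where "c\<^sub>1 = (\<lambda>s. fst u\<^sub>0 - fst (u s))"
  define c\<^sub>2 where "c\<^sub>2 = (\<lambda>s. snd u\<^sub>0 - snd (u s))"
  have "isCont u 0"
    using u(1,2) by (simp add: continuous_on_eq_continuous_at)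
  then have lim: "(u \<longlongrightarrow> u\<^sub>0) (at 0)"
    using u(3) by (simp add: isCont_def)
  have "(c\<^sub>1 \<longlongrightarrow> fst u\<^sub>0 - fst u\<^sub>0) (at 0)" "(c\<^sub>2 \<longlongrightarrow> snd u\<^sub>0 - snd u\<^sub>0) (at 0)"
    unfolding c\<^sub>1_def c\<^sub>2_def by (intro tendsto_intros lim)+
  then have c: "(c\<^sub>1 \<longlongrightarrow> 0) (at 0)" "(c\<^sub>2 \<longlongrightarrow> 0) (at 0)"
    by simp_all
  \<comment> \<open>\<open>H s\<close> is \<open>h (u s)\<close> divided by \<open>t ^ k\<close>: a
    perturbation of \<open>T\<close> whose coefficients tend to 0 with \<open>s\<close>.\<close>
  define H where "H = (\<lambda>s t. T t + (c\<^sub>1 s * a t + c\<^sub>2 s * b t))"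
  have holo_H: "H s holomorphic_on ball 0 R" for s
    unfolding H_def by (intro holomorphic_intros T ab)
  have h_eq: "h (u s) t = t ^ k * H s t" if "t \<in> ball 0 R" for s t
    using h_diff[of "u s" t u\<^sub>0] T(3)[OF that] by (simp add: H_def c\<^sub>1_def c\<^sub>2_def algebra_simps)
  have count: "\<forall>\<^sub>F s in at 0. finite {t \<in> ball 0 \<rho>. H s t = 0} \<and>
      (\<Sum>t | t \<in> ball 0 \<rho> \<and> H s t = 0. zorder (H s) t) = m_branch P Q k u\<^sub>0 \<and>
      (\<forall>t\<in>ball 0 \<rho>. H s t = 0 \<longrightarrow> zorder (H s) t > 0 \<and> (\<forall>\<^sub>F w in at t. H s w \<noteq> 0))"
    if "0 < \<rho>" "\<rho> < R" for \<rho>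
    using Rouche_family[OF T(1) ab that T1(4) T(2) c] T1(7) by (simp add: H_def)
  define \<rho>\<^sub>0 where "\<rho>\<^sub>0 = R / 2"
  have \<rho>\<^sub>0: "0 < \<rho>\<^sub>0" "\<rho>\<^sub>0 < R"
    using R by (auto simp: \<rho>\<^sub>0_def)
  obtain U\<^sub>0 where U\<^sub>0: "open U\<^sub>0" "\<xi> \<in> U\<^sub>0"
      "\<And>t. t \<in> ball 0 r \<Longrightarrow> branch_map P Q k t \<in> U\<^sub>0 \<Longrightarrow> t \<in> ball 0 \<rho>\<^sub>0"
    using branch_map_neighbourhood[OF \<rho>\<^sub>0(1)] by blast
  show ?thesis
  proof (intro exI[of _ U\<^sub>0] conjI U\<^sub>0(1,2) allI impI)
    fix U
    assume U: "open U" "\<xi> \<in> U" "U \<subseteq> U\<^sub>0"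
    obtain \<rho> where \<rho>: "0 < \<rho>" "\<rho> \<le> \<rho>\<^sub>0" "\<And>t. t \<in> ball 0 \<rho> \<Longrightarrow> branch_map P Q k t \<in> U"
      using branch_map_small[OF U(1,2) \<rho>\<^sub>0(1)] by blast
    have "\<forall>\<^sub>F s in at 0. s \<in> ball 0 \<epsilon> - {0 :: complex}"
      using u(1) by (rule eventually_in_punctured_ball)
    moreover note count[OF \<rho>\<^sub>0] count[OF \<rho>(1) le_less_trans[OF \<rho>(2) \<rho>\<^sub>0(2)]]
    ultimately show "\<forall>\<^sub>F s in at 0. finite (S U s) \<and> (\<Sum>p\<in>S U s. milnor F (u s) p) = m_branch P Q k u\<^sub>0 \<and>
        (\<forall>p\<in>S U s. eval2 (partial_y F) p \<noteq> 0)"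
    proof eventually_elim
      case (elim s)
      define Z where "Z = {t \<in> ball 0 \<rho>\<^sub>0. H s t = 0}"
      define Z' where "Z' = {t \<in> ball 0 \<rho>. H s t = 0}"
      have Z: "finite Z" "(\<Sum>t\<in>Z. zorder (H s) t) = m_branch P Q k u\<^sub>0"
        "\<And>t. t \<in> Z \<Longrightarrow> zorder (H s) t > 0" "\<And>t. t \<in> Z \<Longrightarrow> \<forall>\<^sub>F w in at t. H s w \<noteq> 0"
        using elim(2) by (auto simp: Z_def)
      have "Z' \<subseteq> Z"
        using \<rho>(2) by (auto simp: Z_def Z'_def)
      \<comment> \<open>Both disks contain \<open>m_branch P Q k u\<^sub>0\<close> zeros, so none lies in the annulus between them.\<close>
      have "Z' = Z"
      proof (rule ccontr)
        assume "Z' \<noteq> Z"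
        have "(\<Sum>t\<in>Z. zorder (H s) t) = (\<Sum>t\<in>Z - Z'. zorder (H s) t) + (\<Sum>t\<in>Z'. zorder (H s) t)"
          by (rule sum.subset_diff[OF \<open>Z' \<subseteq> Z\<close> Z(1)])
        moreover have "(\<Sum>t\<in>Z'. zorder (H s) t) = m_branch P Q k u\<^sub>0"
          using elim(3) by (simp add: Z'_def)
        moreover have "(\<Sum>t\<in>Z - Z'. zorder (H s) t) > 0"
          using \<open>Z' \<noteq> Z\<close> \<open>Z' \<subseteq> Z\<close> Z by (intro sum_pos) auto
        ultimately show False
          using Z(2) by simp
      qed
      \<comment> \<open>The centre would correspond to \<open>\<xi>\<close> itself, not to an affine
        critical point; \<open>H s 0\<close> is the coefficient assumed nonzero along the
        path.\<close>
      have "H s 0 \<noteq> 0"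
        using h_coeff_k[OF R(1) holo_H h_eq] bspec[OF nz elim(1)] by metis
      then have Z_R: "t \<in> ball 0 R - {0}" if "t \<in> Z" for t
        using that \<rho>\<^sub>0(2) by (auto simp: Z_def)
      have Z_r: "t \<in> ball 0 r - {0}" if "t \<in> Z" for t
        using Z_R[OF that] R(2) by auto
      have inj: "inj_on \<gamma> Z"
        using \<gamma>_inj Z_r by (rule inj_on_subset[OF _ subsetI])
      \<comment> \<open>Points of \<open>U\<close> on the branch have parameters below
        \<open>\<rho>\<^sub>0\<close>; conversely \<open>Z' = Z\<close> puts all zeros into the
        smaller disk, whose image lies in \<open>U\<close>.\<close>
      have "S U s = \<gamma> ` Z"
      proof (intro subset_antisym subsetI)
        fix p assume "p \<in> S U s"
        then have p: "critical_point F (u s) p" "aff p \<in> \<Gamma>" "aff p \<in> U"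
          by (auto simp: S_def)
        obtain t where t: "t \<in> ball 0 r - {0}" "p = \<gamma> t"
          using p(2) aff_in_branch_iff by blast
        then have t0: "t \<in> ball 0 \<rho>\<^sub>0"
          using U\<^sub>0(3)[of t] p(3) U(3) by (auto simp: branch_map_eq_aff)
        then have tR: "t \<in> ball 0 R - {0}"
          using t(1) \<rho>\<^sub>0(2) by auto
        then have "h (u s) t = 0"
          using critical_point_\<gamma>_iff[OF reg] p(1) t(2) by blast
        then have "t \<in> Z"
          using h_eq[of t s] tR t0 by (auto simp: Z_def)
        then show "p \<in> \<gamma> ` Z"
          using t(2) by blast
      next
        fix p assume "p \<in> \<gamma> ` Z"
        then obtain t where t: "t \<in> Z" "p = \<gamma> t"
          by blast
        have "h (u s) t = 0"
          using t(1) Z_R[OF t(1)] h_eq[of t s] by (simp add: Z_def)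
        then have "critical_point F (u s) p"
          using critical_point_\<gamma>_iff[OF reg[OF Z_R[OF t(1)]]] t(2) by blast
        moreover have "aff p \<in> \<Gamma>"
          using Z_r[OF t(1)] t(2) aff_in_branch_iff by blast
        moreover have "aff p \<in> U"
          using \<rho>(3)[of t] t Z_R[OF t(1)] \<open>Z' = Z\<close> by (auto simp: Z'_def branch_map_eq_aff)
        ultimately show "p \<in> S U s"
          by (simp add: S_def)
      qed
      have "milnor F (u s) (\<gamma> t) = zorder (H s) t" if "t \<in> Z" for t
      proof -
        have t: "t \<in> ball 0 R" "t \<noteq> 0"
          using Z_R[OF that] by auto
        have near: "\<forall>\<^sub>F w in at t. w \<in> ball 0 R - {0}"
          using t by (intro eventually_at_in_open'[OF open_delete]) auto
        then have ev: "\<forall>\<^sub>F w in at t. h (u s) w = w ^ k * H s w"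
          by eventually_elim (use h_eq in auto)
        have "\<forall>\<^sub>F w in at t. h (u s) w \<noteq> 0"
          using near ev Z(4)[OF that] by eventually_elim simp
        then have "milnor F (u s) (\<gamma> t) = zorder (h (u s)) t"
          by (rule milnor_\<gamma>[OF reg[OF Z_R[OF that]]])
        also have "\<dots> = zorder (\<lambda>w. w ^ k * H s w) t"
          using ev by (rule zorder_cong) simp
        also have "\<dots> = zorder (H s) t"
          using holo_H t(1) analytic_at by (intro zorder_power_mult t(2) Z(4) that) blast
        finally show ?thesis .
      qed
      then have "(\<Sum>p\<in>S U s. milnor F (u s) p) = m_branch P Q k u\<^sub>0"
        using Z(2) by (simp add: \<open>S U s = \<gamma> ` Z\<close> sum.reindex[OF inj])
      moreover have "\<forall>p\<in>S U s. eval2 (partial_y F) p \<noteq> 0"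
        using reg Z_R by (auto simp: \<open>S U s = \<gamma> ` Z\<close> regular_parameter_def)
      ultimately show ?case
        using Z(1) by (simp add: \<open>S U s = \<gamma> ` Z\<close>)
    qed
  qed
qed

end

text \<open>Both counts follow from \<open>critical_points_near_\<xi>\<close>. Their common value is
  computed from \<open>u\<^sub>0\<close> and the parametrization, hence is the same for all
  paths.\<close>

theorem theorem3p6:
  fixes F :: "complex poly poly"
    and \<Gamma> :: "cp2 set" and \<xi> :: cp2
    and r :: real and P Q :: "complex \<Rightarrow> complex" and k :: nat
    and u\<^sub>0 :: "complex \<times> complex"
  assumes curve: "reduced_equation F"
    and isotropic: "\<xi> \<in> proj_closure F \<inter> Q_inf"
    and branch: "branch_parametrization F \<Gamma> \<xi> r P Q k"
    and atypical: "u\<^sub>0 \<in> atypical_discriminant F \<Gamma> \<xi>"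
    and finite_order: "h_tail P Q k u\<^sub>0 \<noteq> 0"
  shows "m_branch P Q k u\<^sub>0 > 0 \<and>
    (\<forall>\<epsilon> u. \<epsilon> > 0 \<and> continuous_on (ball 0 \<epsilon>) u \<and> u 0 = u\<^sub>0 \<and>
        (\<forall>s \<in> ball 0 \<epsilon> - {0}. h_coeff P Q k k (u s) \<noteq> 0) \<longrightarrow>
      (only_morse_near F \<Gamma> \<xi> u \<longrightarrow>
        abutting_number \<Gamma> \<xi> (\<lambda>s. {p. morse_point F (u s) p}) (m_branch P Q k u\<^sub>0)) \<and>
      abutting_weight \<Gamma> \<xi> (\<lambda>s. {p. critical_point F (u s) p}) (\<lambda>s. milnor F (u s))
        (m_branch P Q k u\<^sub>0))"
proof (intro conjI allI impI)
  interpret isotropic_branch F \<Gamma> \<xi> r P Q k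
    using curve isotropic branch by unfold_locales (auto simp: reduced_equation_def)
  show "m_branch P Q k u\<^sub>0 > 0"
    using h_factorization[OF atypical finite_order] by blast
  fix \<epsilon> :: real and u :: "complex \<Rightarrow> complex \<times> complex"
  assume "\<epsilon> > 0 \<and> continuous_on (ball 0 \<epsilon>) u \<and> u 0 = u\<^sub>0 \<and>
        (\<forall>s \<in> ball 0 \<epsilon> - {0}. h_coeff P Q k k (u s) \<noteq> 0)"
  then have u: "\<epsilon> > 0" "continuous_on (ball 0 \<epsilon>) u" "u 0 = u\<^sub>0"
    "\<forall>s \<in> ball 0 \<epsilon> - {0}. h_coeff P Q k k (u s) \<noteq> 0"
    by blast+
  obtain U\<^sub>0 where U\<^sub>0: "open U\<^sub>0" "\<xi> \<in> U\<^sub>0"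
    "\<forall>U. open U \<longrightarrow> \<xi> \<in> U \<longrightarrow> U \<subseteq> U\<^sub>0 \<longrightarrow>
      (\<forall>\<^sub>F s in at 0. finite {p. critical_point F (u s) p \<and> aff p \<in> \<Gamma> \<inter> U} \<and>
        (\<Sum>p | critical_point F (u s) p \<and> aff p \<in> \<Gamma> \<inter> U. milnor F (u s) p) = m_branch P Q k u\<^sub>0 \<and>
        (\<forall>p\<in>{p. critical_point F (u s) p \<and> aff p \<in> \<Gamma> \<inter> U}. eval2 (partial_y F) p \<noteq> 0))"
    using critical_points_near_\<xi>[OF atypical finite_order u] by (elim exE conjE) (rule that)
  show "abutting_weight \<Gamma> \<xi> (\<lambda>s. {p. critical_point F (u s) p}) (\<lambda>s. milnor F (u s)) (m_branch P Q k u\<^sub>0)"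
    unfolding abutting_weight_def
  proof (intro exI[of _ U\<^sub>0] conjI U\<^sub>0(1,2) allI impI)
    fix U assume "open U \<and> \<xi> \<in> U \<and> U \<subseteq> U\<^sub>0"
    then show "\<forall>\<^sub>F s in at 0. finite {p \<in> {p. critical_point F (u s) p}. aff p \<in> \<Gamma> \<inter> U} \<and>
        (\<Sum>p | p \<in> {p. critical_point F (u s) p} \<and> aff p \<in> \<Gamma> \<inter> U. milnor F (u s) p) = m_branch P Q k u\<^sub>0"
      using U\<^sub>0(3)[rule_format, of U] by (auto elim: eventually_mono)
  qed
  assume "only_morse_near F \<Gamma> \<xi> u"
  then obtain V where V: "open V" "\<xi> \<in> V"
    "\<forall>\<^sub>F s in at 0. \<forall>p. critical_point F (u s) p \<and> aff p \<in> \<Gamma> \<inter> V \<longrightarrow> morse_point F (u s) p"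
    unfolding only_morse_near_def by blast
  show "abutting_number \<Gamma> \<xi> (\<lambda>s. {p. morse_point F (u s) p}) (m_branch P Q k u\<^sub>0)"
    unfolding abutting_number_def
  \<comment> \<open>Inside \<open>U\<^sub>0\<close> the weighted count is valid, and inside
    \<open>V\<close> all critical points are Morse.\<close>
  proof (intro exI[of _ "U\<^sub>0 \<inter> V"] conjI allI impI)
    fix U assume U: "open U \<and> \<xi> \<in> U \<and> U \<subseteq> U\<^sub>0 \<inter> V"
    then have "U \<subseteq> U\<^sub>0"
      by blast
    have "\<forall>\<^sub>F s in at 0. finite {p. critical_point F (u s) p \<and> aff p \<in> \<Gamma> \<inter> U} \<and>
        (\<Sum>p | critical_point F (u s) p \<and> aff p \<in> \<Gamma> \<inter> U. milnor F (u s) p) = m_branch P Q k u\<^sub>0 \<and>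
        (\<forall>p\<in>{p. critical_point F (u s) p \<and> aff p \<in> \<Gamma> \<inter> U}. eval2 (partial_y F) p \<noteq> 0)"
      using U\<^sub>0(3)[rule_format, OF _ _ \<open>U \<subseteq> U\<^sub>0\<close>] U by simp
    with V(3) show "\<forall>\<^sub>F s in at 0. finite {p \<in> {p. morse_point F (u s) p}. aff p \<in> \<Gamma> \<inter> U} \<and>
        int (card {p \<in> {p. morse_point F (u s) p}. aff p \<in> \<Gamma> \<inter> U}) = m_branch P Q k u\<^sub>0"
    proof eventually_elim
      case (elim s)
      let ?S = "{p. critical_point F (u s) p \<and> aff p \<in> \<Gamma> \<inter> U}"
      have morse: "morse_point F (u s) p" if "p \<in> ?S" for p
        using elim(1) that U by blast
      then have eq: "{p \<in> {p. morse_point F (u s) p}. aff p \<in> \<Gamma> \<inter> U} = ?S"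
        using morse_point_imp_critical_point by blast
      \<comment> \<open>Every weight is 1 at a Morse point, so the weighted count is the
        cardinality.\<close>
      have "(\<Sum>p\<in>?S. milnor F (u s) p) = (\<Sum>p\<in>?S. 1)"
        using elim(2) morse by (intro sum.cong refl milnor_morse_point) auto
      then show ?case
        unfolding eq using elim(2) by simp
    qed
  qed (use U\<^sub>0 V in auto)
qed

end
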